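(* Let $K$ be a field, $R=L_K(\mathcal{T})$, and $f(x)\in\mathcal{F}$. Then $U^f$ is the injective envelope of the simple left $R$-module $V^f$.
   Context: $R=L_K(\mathcal{T})$ is the Leavitt path algebra over the field $K$ of the graph $\mathcal{T}$ with two vertices $v,w$, a loop $c$ at $v$, and one edge $d$ from $v$ to $w$. That is, $R$ is the unital associative $K$-algebra generated by $v,w,c,d,c^*,d^*$ with relations $v^2=v$, $w^2=w$, $vw=wv=0$, $v+w=1_R$, $c=vc=cv$, $c^*=vc^*=c^*v$, $d=vd=dw$, $d^*=wd^*=d^*v$, $c^*c=v$, $d^*d=w$, $c^*d=d^*c=0$, $cc^*+dd^*=v$. "Module" means left module. For $g(x)=\sum_{i=0}^m k_ix^i\in K[x]$, set $g(c):=k_01_R+k_1c+\cdots+k_mc^m\in R$. $\mathcal{F}$ is the set of polynomials $f(x)\in K[x]$ that are irreducible in $K[x]$ with $f(0)=-1$. $f^n$ denotes the $n$-th power of $f$; $\mathbb N=\{1,2,\dots\}$. The module $V^f$: let $K'=K[x]/\langle f(x)\rangle$ and $\overline{x}=x+\langle f(x)\rangle\in K'$. $V^f$ is the one-dimensional $K'$-vector space with basis element denoted $c^\infty$, regarded as a left $R$-module ($K$ acting by restriction of scalars from $K'$) via the $K'$-linear actions determined by $d\star c^\infty=d^*\star c^\infty=w\star c^\infty=0$, $v\star c^\infty=c^\infty$, $c\star c^\infty=\overline{x}c^\infty$, $c^*\star c^\infty=\overline{x}^{-1}c^\infty$. It is a simple left $R$-module. For $n\in\mathbb N$, $M_n^f:=R/Rf^n(c)$;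 for $i\le \ell$, $\psi_{i,\ell}:M_i^f\to M_\ell^f$ is the ($R$-linear, injective) map $1+Rf^i(c)\mapsto f^{\ell-i}(c)+Rf^\ell(c)$; and $U^f:=\varinjlim\{M_i^f,\psi_{i,j}\}_{i\le j}$. Each $M_i^f$ is identified with its image in $U^f$, and $M_1^f=R/Rf(c)\cong V^f$ via $1+Rf(c)\mapsto c^\infty$; this is the copy of $V^f$ in $U^f$. *)

theory Defs
  imports
    "HOL-Library.Poly_Mapping"
    "HOL-Computational_Algebra.Polynomial"
    "HOL-Algebra.QuotRing"
    "HOL-Algebra.Module"
    "HOL-Algebra.Algebraic_Closure_Type"
begin

section \<open>Left modules over a not necessarily commutative ring\<close>

text \<open>
  The library locale \<^locale>\<open>module\<close> requires a commutative ring; the following is the same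
  list of axioms over a \<^locale>\<open>ring\<close>. The fields \<open>mult\<close> and \<open>one\<close> of a module record
  play no role.
\<close>

locale left_module = R?: ring R + M?: abelian_group M
  for R :: "('r, 'x) ring_scheme" (structure) and M :: "('r, 'm) module" (structure) +
  assumes smult_closed [simp, intro]:
      "\<lbrakk>a \<in> carrier R; x \<in> carrier M\<rbrakk> \<Longrightarrow> a \<odot>\<^bsub>M\<^esub> x \<in> carrier M"
    and smult_l_distr:
      "\<lbrakk>a \<in> carrier R; b \<in> carrier R; x \<in> carrier M\<rbrakk> \<Longrightarrow>
        (a \<oplus>\<^bsub>R\<^esub> b) \<odot>\<^bsub>M\<^esub> x = a \<odot>\<^bsub>M\<^esub> x \<oplus>\<^bsub>M\<^esub> b \<odot>\<^bsub>M\<^esub> x"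
    and smult_r_distr:
      "\<lbrakk>a \<in> carrier R; x \<in> carrier M; y \<in> carrier M\<rbrakk> \<Longrightarrow>
        a \<odot>\<^bsub>M\<^esub> (x \<oplus>\<^bsub>M\<^esub> y) = a \<odot>\<^bsub>M\<^esub> x \<oplus>\<^bsub>M\<^esub> a \<odot>\<^bsub>M\<^esub> y"
    and smult_assoc:
      "\<lbrakk>a \<in> carrier R; b \<in> carrier R; x \<in> carrier M\<rbrakk> \<Longrightarrow>
        (a \<otimes>\<^bsub>R\<^esub> b) \<odot>\<^bsub>M\<^esub> x = a \<odot>\<^bsub>M\<^esub> (b \<odot>\<^bsub>M\<^esub> x)"
    and smult_one [simp]:
      "x \<in> carrier M \<Longrightarrow> \<one>\<^bsub>R\<^esub> \<odot>\<^bsub>M\<^esub> x = x"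

definition lmod_hom ::
  "('r, 'x) ring_scheme \<Rightarrow> ('r, 'm) module \<Rightarrow> ('r, 'n) module \<Rightarrow> ('m \<Rightarrow> 'n) set" where
  "lmod_hom R M N =
    {h \<in> carrier M \<rightarrow> carrier N.
      (\<forall>x\<in>carrier M. \<forall>y\<in>carrier M. h (x \<oplus>\<^bsub>M\<^esub> y) = h x \<oplus>\<^bsub>N\<^esub> h y) \<and>
      (\<forall>r\<in>carrier R. \<forall>x\<in>carrier M. h (r \<odot>\<^bsub>M\<^esub> x) = r \<odot>\<^bsub>N\<^esub> h x)}"

definition simple_left_module :: "('r, 'x) ring_scheme \<Rightarrow> ('r, 'm) module \<Rightarrow> bool" where
  "simple_left_module R M \<longleftrightarrow>
    left_module R M \<and> carrier M \<noteq> {\<zero>\<^bsub>M\<^esub>} \<and>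
    (\<forall>N. submodule N R M \<longrightarrow> N = {\<zero>\<^bsub>M\<^esub>} \<or> N = carrier M)"

text \<open>
  HOL cannot quantify over types inside a formula, so the types of the elements of the test modules
  \<open>A\<close> and \<open>B\<close> are parameters. A theorem concluding
  \<open>injective_left_module TYPE('a) TYPE('b) R E\<close> with \<open>'a\<close> and \<open>'b\<close> type variables that
  occur nowhere else asserts the extension property for all modules.
\<close>

definition injective_left_module ::
  "'a itself \<Rightarrow> 'b itself \<Rightarrow> ('r, 'x) ring_scheme \<Rightarrow> ('r, 'm) module \<Rightarrow> bool" where
  "injective_left_module _ _ R E \<longleftrightarrow>
    left_module R E \<and>
    (\<forall>(A :: ('r, 'a) module) (B :: ('r, 'b) module) i g.
      left_module R A \<and> left_module R B \<and>
      i \<in> lmod_hom R A B \<and> inj_on i (carrier A) \<and> g \<in> lmod_hom R A E \<longrightarrow>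
      (\<exists>h \<in> lmod_hom R B E. \<forall>x\<in>carrier A. h (i x) = g x))"

definition essential_monomorphism ::
  "('r, 'x) ring_scheme \<Rightarrow> ('r, 'm) module \<Rightarrow> ('r, 'n) module \<Rightarrow> ('m \<Rightarrow> 'n) \<Rightarrow> bool" where
  "essential_monomorphism R M E \<iota> \<longleftrightarrow>
    left_module R M \<and> left_module R E \<and>
    \<iota> \<in> lmod_hom R M E \<and> inj_on \<iota> (carrier M) \<and>
    (\<forall>N. submodule N R E \<and> N \<noteq> {\<zero>\<^bsub>E\<^esub>} \<longrightarrow> N \<inter> \<iota> ` carrier M \<noteq> {\<zero>\<^bsub>E\<^esub>})"

definition injective_envelope ::
  "'a itself \<Rightarrow> 'b itself \<Rightarrow> ('r, 'x) ring_scheme \<Rightarrow> ('r, 'm) module \<Rightarrow> ('r, 'n) module \<Rightarrow>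
    ('m \<Rightarrow> 'n) \<Rightarrow> bool" where
  "injective_envelope ta tb R M E \<iota> \<longleftrightarrow>
    injective_left_module ta tb R E \<and> essential_monomorphism R M E \<iota>"

definition ring_mod_left_ideal :: "('r, 'x) ring_scheme \<Rightarrow> 'r set \<Rightarrow> ('r, 'r set) module" where
  "ring_mod_left_ideal R J =
    \<lparr>carrier = a_rcosets\<^bsub>R\<^esub> J, monoid.mult = undefined, one = undefined,
     ring.zero = J, add = set_add R,
     module.smult = (\<lambda>r S. \<Union>x\<in>S. J +>\<^bsub>R\<^esub> (r \<otimes>\<^bsub>R\<^esub> x))\<rparr>"

definition principal_left_ideal :: "('r, 'x) ring_scheme \<Rightarrow> 'r \<Rightarrow> 'r set" where
  "principal_left_ideal R a = {r \<otimes>\<^bsub>R\<^esub> a | r. r \<in> carrier R}"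


section \<open>Direct limits\<close>

text \<open>
  \<open>\<psi> i j\<close> is the transition map from \<open>M i\<close> to \<open>M j\<close>, for \<open>i \<le> j\<close> in the directed set
  \<open>I\<close>. The limit is the disjoint union of the \<open>M i\<close> modulo \<open>dlim_rel I M \<psi>\<close>.
\<close>

definition dlim_rel ::
  "'i::order set \<Rightarrow> ('i \<Rightarrow> ('r, 'm) module) \<Rightarrow> ('i \<Rightarrow> 'i \<Rightarrow> 'm \<Rightarrow> 'm) \<Rightarrow>
    (('i \<times> 'm) \<times> ('i \<times> 'm)) set" where
  "dlim_rel I M \<psi> =
    {((i, x), (j, y)) | i x j y.
      i \<in> I \<and> j \<in> I \<and> x \<in> carrier (M i) \<and> y \<in> carrier (M j) \<and>
      (\<exists>k\<in>I. i \<le> k \<and> j \<le> k \<and> \<psi> i k x = \<psi> j k y)}"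

definition dlim_incl ::
  "'i::order set \<Rightarrow> ('i \<Rightarrow> ('r, 'm) module) \<Rightarrow> ('i \<Rightarrow> 'i \<Rightarrow> 'm \<Rightarrow> 'm) \<Rightarrow>
    'i \<Rightarrow> 'm \<Rightarrow> ('i \<times> 'm) set" where
  "dlim_incl I M \<psi> i x = dlim_rel I M \<psi> `` {(i, x)}"

text \<open>
  As in the library's quotient rings, the operations take unions over all representatives; all the
  sets united are the same class.
\<close>

definition direct_limit ::
  "'i::order set \<Rightarrow> ('i \<Rightarrow> ('r, 'm) module) \<Rightarrow> ('i \<Rightarrow> 'i \<Rightarrow> 'm \<Rightarrow> 'm) \<Rightarrow>
    ('r, ('i \<times> 'm) set) module" where
  "direct_limit I M \<psi> =
    \<lparr>carrier = (SIGMA i:I. carrier (M i)) // dlim_rel I M \<psi>,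
     monoid.mult = undefined, one = undefined,
     ring.zero = (\<Union>i\<in>I. dlim_incl I M \<psi> i \<zero>\<^bsub>M i\<^esub>),
     add = (\<lambda>S T. \<Union>(i, x)\<in>S. \<Union>(j, y)\<in>T. \<Union>k\<in>{k \<in> I. i \<le> k \<and> j \<le> k}.
              dlim_incl I M \<psi> k (\<psi> i k x \<oplus>\<^bsub>M k\<^esub> \<psi> j k y)),
     module.smult = (\<lambda>r S. \<Union>(i, x)\<in>S. dlim_incl I M \<psi> i (r \<odot>\<^bsub>M i\<^esub> x))\<rparr>"


section \<open>The Leavitt path algebra of the Toeplitz graph\<close>

datatype gen = GV | GW | GC | GD | GC' | GD'

text \<open>
  Words form a monoid under concatenation. With this instance the type of finitely supported
  functions from words to \<open>'k\<close>, whose product is convolution, is the free unital associative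
  \<open>'k\<close>-algebra on the generators.
\<close>

instantiation list :: (type) monoid_add
begin
definition zero_list :: "'a list" where "zero_list = []"
definition plus_list :: "'a list \<Rightarrow> 'a list \<Rightarrow> 'a list" where "plus_list = (@)"
instance by standard (simp_all add: zero_list_def plus_list_def)
end

type_synonym 'k free_alg = "gen list \<Rightarrow>\<^sub>0 'k"

abbreviation word :: "gen list \<Rightarrow> 'k::field free_alg" where
  "word u \<equiv> Poly_Mapping.single u 1"

abbreviation free_scalar :: "'k::field \<Rightarrow> 'k free_alg" where
  "free_scalar k \<equiv> Poly_Mapping.single [] k"

definition toeplitz_relations :: "('k::field free_alg \<times> 'k free_alg) set" where
  "toeplitz_relations =
    {(word [GV, GV], word [GV]), (word [GW, GW], word [GW]),
     (word [GV, GW], 0), (word [GW, GV], 0),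
     (word [GV] + word [GW], 1),
     (word [GC], word [GV, GC]), (word [GC], word [GC, GV]),
     (word [GC'], word [GV, GC']), (word [GC'], word [GC', GV]),
     (word [GD], word [GV, GD]), (word [GD], word [GD, GW]),
     (word [GD'], word [GW, GD']), (word [GD'], word [GD', GV]),
     (word [GC', GC], word [GV]), (word [GD', GD], word [GW]),
     (word [GC', GD], 0), (word [GD', GC], 0),
     (word [GC, GC'] + word [GD, GD'], word [GV])}"

text \<open>Closure under scalars is the case of \<open>mult\<close> in which one factor is a multiple of the empty word.\<close>

inductive toeplitz_cong :: "'k::field free_alg \<Rightarrow> 'k free_alg \<Rightarrow> bool" where
  rel: "(a, b) \<in> toeplitz_relations \<Longrightarrow> toeplitz_cong a b"
| refl: "toeplitz_cong a a"
| sym: "toeplitz_cong a b \<Longrightarrow> toeplitz_cong b a"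
| trans: "toeplitz_cong a b \<Longrightarrow> toeplitz_cong b c \<Longrightarrow> toeplitz_cong a c"
| add: "toeplitz_cong a b \<Longrightarrow> toeplitz_cong a' b' \<Longrightarrow> toeplitz_cong (a + a') (b + b')"
| mult: "toeplitz_cong a b \<Longrightarrow> toeplitz_cong a' b' \<Longrightarrow> toeplitz_cong (a * a') (b * b')"

lemma toeplitz_cong_uminus: "toeplitz_cong a b \<Longrightarrow> toeplitz_cong (- a) (- b)"
  using toeplitz_cong.mult[OF toeplitz_cong.refl[of "- 1"], of a b] by simp

lemma toeplitz_cong_diff:
  "toeplitz_cong a b \<Longrightarrow> toeplitz_cong a' b' \<Longrightarrow> toeplitz_cong (a - a') (b - b')"
  using toeplitz_cong.add[OF _ toeplitz_cong_uminus, of a b a' b'] by simp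

text \<open>The algebra is not zero: it has the character \<open>v, c, c\<^sup>* \<mapsto> 1\<close>, \<open>w, d, d\<^sup>* \<mapsto> 0\<close>.\<close>

definition word_char :: "gen list \<Rightarrow> 'k::field" where
  "word_char u = (if set u \<subseteq> {GV, GC, GC'} then 1 else 0)"

definition free_char :: "'k::field free_alg \<Rightarrow> 'k" where
  "free_char p = (\<Sum>u\<in>Poly_Mapping.keys p. Poly_Mapping.lookup p u * word_char u)"

lemma free_char_superset:
  assumes "finite S" "Poly_Mapping.keys p \<subseteq> S"
  shows "free_char p = (\<Sum>u\<in>S. Poly_Mapping.lookup p u * word_char u)"
  unfolding free_char_def using assms
  by (intro sum.mono_neutral_left) (auto simp: in_keys_iff)

lemma free_char_add: "free_char (p + q) = free_char p + free_char q"
proof -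
  let ?S = "Poly_Mapping.keys p \<union> Poly_Mapping.keys q"
  have "Poly_Mapping.keys (p + q) \<subseteq> ?S" by (rule Poly_Mapping.keys_add)
  then show ?thesis
    by (simp add: free_char_superset[of ?S] lookup_add sum.distrib distrib_right)
qed

lemma free_char_zero [simp]: "free_char 0 = 0"
  by (simp add: free_char_def)

lemma free_char_sum: "free_char (sum h A) = (\<Sum>a\<in>A. free_char (h a))"
  by (induction A rule: infinite_finite_induct) (simp_all add: free_char_add)

lemma free_char_single [simp]: "free_char (Poly_Mapping.single u k) = k * word_char u"
  by (simp add: free_char_def)

lemma word_char_append: "word_char (u + u') = word_char u * word_char u'"
  by (simp add: word_char_def plus_list_def)

lemma free_char_mult: "free_char (p * q) = free_char p * free_char q"
proof -
  let ?s = "\<lambda>r u. Poly_Mapping.single u (Poly_Mapping.lookup r u)"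
  have decomp: "r = sum (?s r) (Poly_Mapping.keys r)" for r :: "'a free_alg"
    by (rule poly_mapping_eqI)
      (simp add: lookup_sum lookup_single when_def in_keys_iff)
  have "free_char (p * q) =
      free_char (sum (?s p) (Poly_Mapping.keys p) * sum (?s q) (Poly_Mapping.keys q))"
    using decomp[of p] decomp[of q] by simp
  also have "\<dots> = (\<Sum>u\<in>Poly_Mapping.keys p. \<Sum>u'\<in>Poly_Mapping.keys q.
      (Poly_Mapping.lookup p u * word_char u) * (Poly_Mapping.lookup q u' * word_char u'))"
    by (simp add: sum_product free_char_sum mult_single word_char_append mult_ac)
  also have "\<dots> = free_char p * free_char q"
    by (simp add: free_char_def sum_product)
  finally show ?thesis .
qed

lemma free_char_cong: "toeplitz_cong a b \<Longrightarrow> free_char a = free_char b"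
proof (induction rule: toeplitz_cong.induct)
  case (rel a b)
  moreover have "free_char 1 = 1"
    using free_char_single[of "[]" 1]
    by (simp add: word_char_def single_one[symmetric] zero_list_def del: single_one)
  ultimately show ?case
    by (auto simp: toeplitz_relations_def free_char_add word_char_def)
qed (simp_all add: free_char_add free_char_mult)

quotient_type (overloaded) 'k toeplitz_lpa = "'k::field free_alg" / toeplitz_cong
  by (rule equivpI)
    (auto intro!: reflpI sympI transpI intro: toeplitz_cong.refl toeplitz_cong.sym toeplitz_cong.trans)

instantiation toeplitz_lpa :: (field) ring_1
begin

lift_definition zero_toeplitz_lpa :: "'a toeplitz_lpa" is 0 .
lift_definition one_toeplitz_lpa :: "'a toeplitz_lpa" is 1 .
lift_definition plus_toeplitz_lpa :: "'a toeplitz_lpa \<Rightarrow> 'a toeplitz_lpa \<Rightarrow> 'a toeplitz_lpa"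
  is "(+)" by (rule toeplitz_cong.add)
lift_definition times_toeplitz_lpa :: "'a toeplitz_lpa \<Rightarrow> 'a toeplitz_lpa \<Rightarrow> 'a toeplitz_lpa"
  is "(*)" by (rule toeplitz_cong.mult)
lift_definition uminus_toeplitz_lpa :: "'a toeplitz_lpa \<Rightarrow> 'a toeplitz_lpa"
  is uminus by (rule toeplitz_cong_uminus)
lift_definition minus_toeplitz_lpa :: "'a toeplitz_lpa \<Rightarrow> 'a toeplitz_lpa \<Rightarrow> 'a toeplitz_lpa"
  is "(-)" by (rule toeplitz_cong_diff)

instance
proof
  have "\<not> toeplitz_cong (0 :: 'a free_alg) 1"
    using free_char_cong[of "0 :: 'a free_alg" 1] free_char_single[of "[]" "1 :: 'a"]
    by (auto simp: word_char_def single_one[symmetric] zero_list_def simp del: single_one)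
  then show "(0 :: 'a toeplitz_lpa) \<noteq> 1" by transfer
qed (transfer; simp add: algebra_simps toeplitz_cong.refl)+

end

abbreviation toeplitz_ring :: "'k::field toeplitz_lpa ring" where
  "toeplitz_ring \<equiv> ring_of_type_algebra"

lift_definition lpa_scalar :: "'k::field \<Rightarrow> 'k toeplitz_lpa" is free_scalar .
lift_definition lpa_gen :: "gen \<Rightarrow> 'k::field toeplitz_lpa" is "\<lambda>g. word [g]" .

lemma ring_toeplitz_ring: "ring (toeplitz_ring :: 'k::field toeplitz_lpa ring)"
proof -
  have "\<exists>y. x + y = 0" for x :: "'k toeplitz_lpa"
    using add.right_inverse by blast
  then show ?thesis
    unfolding ring_of_type_algebra_def using add.right_inverse
    by unfold_locales (auto simp: algebra_simps Units_def)
qed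

definition poly_c :: "'k::field poly \<Rightarrow> 'k toeplitz_lpa" where
  "poly_c g = (\<Sum>i\<le>degree g. lpa_scalar (poly.coeff g i) * lpa_gen GC ^ i)"


section \<open>The modules \<open>V\<^sup>f\<close>, \<open>M\<^sub>n\<^sup>f\<close> and \<open>U\<^sup>f\<close>\<close>

definition residue_field :: "'k::field poly \<Rightarrow> 'k poly set ring" where
  "residue_field f = ring_of_type_algebra Quot (PIdl\<^bsub>ring_of_type_algebra\<^esub> f)"

definition residue :: "'k::field poly \<Rightarrow> 'k poly \<Rightarrow> 'k poly set" where
  "residue f p = (PIdl\<^bsub>ring_of_type_algebra\<^esub> f) +>\<^bsub>ring_of_type_algebra\<^esub> p"

text \<open>
  The element \<open>a \<cdot> c\<^sup>\<infinity>\<close> of \<open>V\<^sup>f\<close> is represented by \<open>a \<in> K'\<close>; in particular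
  \<open>c\<^sup>\<infinity>\<close> is \<open>\<one>\<close>. Generators act by \<open>K'\<close>-linear maps, words by composition, and
  elements of the free algebra by \<open>K\<close>-linear combinations of these. An element of the Leavitt
  path algebra acts as any of its representatives in the free algebra does.
\<close>

fun gen_scalar :: "'k::field poly \<Rightarrow> gen \<Rightarrow> 'k poly set" where
  "gen_scalar f GV = \<one>\<^bsub>residue_field f\<^esub>"
| "gen_scalar f GW = \<zero>\<^bsub>residue_field f\<^esub>"
| "gen_scalar f GC = residue f [:0, 1:]"
| "gen_scalar f GC' = inv\<^bsub>residue_field f\<^esub> (residue f [:0, 1:])"
| "gen_scalar f GD = \<zero>\<^bsub>residue_field f\<^esub>"
| "gen_scalar f GD' = \<zero>\<^bsub>residue_field f\<^esub>"

definition word_act :: "'k::field poly \<Rightarrow> gen list \<Rightarrow> 'k poly set \<Rightarrow> 'k poly set" where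
  "word_act f u y = foldr (\<lambda>g z. gen_scalar f g \<otimes>\<^bsub>residue_field f\<^esub> z) u y"

definition free_act :: "'k::field poly \<Rightarrow> 'k free_alg \<Rightarrow> 'k poly set \<Rightarrow> 'k poly set" where
  "free_act f p y =
    (\<Oplus>\<^bsub>residue_field f\<^esub>u\<in>Poly_Mapping.keys p.
      residue f [:Poly_Mapping.lookup p u:] \<otimes>\<^bsub>residue_field f\<^esub> word_act f u y)"

definition V_mod :: "'k::field poly \<Rightarrow> ('k toeplitz_lpa, 'k poly set) module" where
  "V_mod f =
    \<lparr>carrier = carrier (residue_field f), monoid.mult = undefined, one = undefined,
     ring.zero = \<zero>\<^bsub>residue_field f\<^esub>, add = ring.add (residue_field f),
     module.smult = (\<lambda>r y. free_act f (rep_toeplitz_lpa r) y)\<rparr>"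

definition c_inf :: "'k::field poly \<Rightarrow> 'k poly set" where
  "c_inf f = \<one>\<^bsub>residue_field f\<^esub>"

definition M_mod :: "'k::field poly \<Rightarrow> nat \<Rightarrow> ('k toeplitz_lpa, 'k toeplitz_lpa set) module" where
  "M_mod f n = ring_mod_left_ideal toeplitz_ring (principal_left_ideal toeplitz_ring (poly_c (f ^ n)))"

text \<open>\<open>r + R f\<^sup>i(c) \<mapsto> r f\<^bsup>l - i\<^esup>(c) + R f\<^sup>l(c)\<close>\<close>

definition M_trans ::
  "'k::field poly \<Rightarrow> nat \<Rightarrow> nat \<Rightarrow> 'k toeplitz_lpa set \<Rightarrow> 'k toeplitz_lpa set" where
  "M_trans f i l S =
    (\<Union>r\<in>S. principal_left_ideal toeplitz_ring (poly_c (f ^ l))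
              +>\<^bsub>toeplitz_ring\<^esub> (r * poly_c (f ^ (l - i))))"

definition U_mod ::
  "'k::field poly \<Rightarrow> ('k toeplitz_lpa, (nat \<times> 'k toeplitz_lpa set) set) module" where
  "U_mod f = direct_limit {1..} (M_mod f) (M_trans f)"

text \<open>
  The isomorphism \<open>M\<^sub>1\<^sup>f \<cong> V\<^sup>f\<close>, \<open>r + R f(c) \<mapsto> r \<star> c\<^sup>\<infinity>\<close>, and the resulting
  embedding of \<open>V\<^sup>f\<close> into \<open>U\<^sup>f\<close>.
\<close>

definition M1_to_V :: "'k::field poly \<Rightarrow> 'k toeplitz_lpa set \<Rightarrow> 'k poly set" where
  "M1_to_V f S = the_elem ((\<lambda>r. r \<odot>\<^bsub>V_mod f\<^esub> c_inf f) ` S)"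

definition V_to_U :: "'k::field poly \<Rightarrow> 'k poly set \<Rightarrow> (nat \<times> 'k toeplitz_lpa set) set" where
  "V_to_U f y =
    dlim_incl {1..} (M_mod f) (M_trans f) 1 (inv_into (carrier (M_mod f 1)) (M1_to_V f) y)"

end

theory Submission
  imports Defs "HOL-Number_Theory.Cong"
begin

text \<open>
  Put y = c* + d*. The relations say that left multiplication by y is a one-sided shift: every
  element r of the algebra satisfies y^n r = p(y) for some n and some polynomial p
  (\<open>ex_shift_power_mult_eq_poly_at\<close>). So on a module where y acts injectively, the action of the
  whole algebra is determined by that of the commutative principal ideal domain K[y].

  For a polynomial F prime to x, the map v, c, c* \<mapsto> 1, x, 1/x, killing w, d, d*, is a well defined
  homomorphism from R to K[x]/F, and its kernel is exactly the left ideal R F(c) (\<open>mem_RF_iff\<close>).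
  Hence R/R F(c) is K[x]/F, on which y acts as the inverse of x. With F = f^n this gives the M_n,
  and the limit U is the Pruefer module of f: its elements are the fractions p/f^n modulo
  polynomials, written \<open>prufer_elt n p\<close> below. The first stage, of the fractions p/f, is V.

  Injectivity is checked with Baer's criterion (\<open>baer_criterion\<close>). Let \<phi> be a homomorphism from a
  left ideal I of R to U. The polynomials p with p(y) in I form an ideal of K[x], generated by
  some q. Since q(y) acts surjectively on U unless q = 0 (\<open>poly_at_shift_surjective\<close>), some e in U
  satisfies q(y) e = \<phi>(q(y)). For r in I, the reduction y^n r = p(y) forces q to divide p, so y^n
  \<phi>(r) = y^n r e, and y can be cancelled (\<open>shift_power_injective\<close>): \<phi> is right multiplication by
  e.

  Essentiality and simplicity both come from inverting polynomials prime to f modulo powers of f: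
  a nonzero fraction in lowest terms p/f^(m+1) is carried to 1/f, which lies in V, by a polynomial
  in c.
\<close>

section \<open>Left modules\<close>

lemma lmod_homI:
  assumes "\<And>x. x \<in> carrier M \<Longrightarrow> h x \<in> carrier N"
    and "\<And>x y. x \<in> carrier M \<Longrightarrow> y \<in> carrier M \<Longrightarrow> h (x \<oplus>\<^bsub>M\<^esub> y) = h x \<oplus>\<^bsub>N\<^esub> h y"
    and "\<And>r x. r \<in> carrier R \<Longrightarrow> x \<in> carrier M \<Longrightarrow> h (r \<odot>\<^bsub>M\<^esub> x) = r \<odot>\<^bsub>N\<^esub> h x"
  shows "h \<in> lmod_hom R M N"
  using assms by (auto simp: lmod_hom_def)

lemma
  assumes "h \<in> lmod_hom R M N"
  shows lmod_hom_closed: "x \<in> carrier M \<Longrightarrow> h x \<in> carrier N"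
    and lmod_hom_add:
      "x \<in> carrier M \<Longrightarrow> y \<in> carrier M \<Longrightarrow> h (x \<oplus>\<^bsub>M\<^esub> y) = h x \<oplus>\<^bsub>N\<^esub> h y"
    and lmod_hom_smult: "r \<in> carrier R \<Longrightarrow> x \<in> carrier M \<Longrightarrow> h (r \<odot>\<^bsub>M\<^esub> x) = r \<odot>\<^bsub>N\<^esub> h x"
  using assms by (auto simp: lmod_hom_def)

context left_module
begin

lemma smult_zero_left: "x \<in> carrier M \<Longrightarrow> \<zero>\<^bsub>R\<^esub> \<odot>\<^bsub>M\<^esub> x = \<zero>\<^bsub>M\<^esub>"
  using smult_l_distr[of "\<zero>\<^bsub>R\<^esub>" "\<zero>\<^bsub>R\<^esub>" x]
  by (metis M.add.l_cancel_one R.add.one_closed R.l_zero smult_closed)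

lemma smult_zero_right: "a \<in> carrier R \<Longrightarrow> a \<odot>\<^bsub>M\<^esub> \<zero>\<^bsub>M\<^esub> = \<zero>\<^bsub>M\<^esub>"
  using smult_r_distr[of a "\<zero>\<^bsub>M\<^esub>" "\<zero>\<^bsub>M\<^esub>"]
  by (metis M.add.l_cancel_one M.zero_closed M.l_zero smult_closed)

lemma smult_minus_one: "x \<in> carrier M \<Longrightarrow> (\<ominus>\<^bsub>R\<^esub> \<one>\<^bsub>R\<^esub>) \<odot>\<^bsub>M\<^esub> x = \<ominus>\<^bsub>M\<^esub> x"
  by (metis M.minus_equality R.add.inv_closed R.l_neg R.one_closed smult_closed
      smult_l_distr smult_one smult_zero_left)

lemma smult_uminus_right:
  assumes "a \<in> carrier R" "x \<in> carrier M"
  shows "a \<odot>\<^bsub>M\<^esub> (\<ominus>\<^bsub>M\<^esub> x) = \<ominus>\<^bsub>M\<^esub> (a \<odot>\<^bsub>M\<^esub> x)"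
proof -
  have "a \<odot>\<^bsub>M\<^esub> (\<ominus>\<^bsub>M\<^esub> x) \<oplus>\<^bsub>M\<^esub> a \<odot>\<^bsub>M\<^esub> x = \<zero>\<^bsub>M\<^esub>"
    using assms smult_r_distr[of a "\<ominus>\<^bsub>M\<^esub> x" x] by (simp add: M.l_neg smult_zero_right)
  then show ?thesis using assms by (simp add: M.minus_equality)
qed

lemma smult_cancel:
  assumes kernel: "\<And>z. z \<in> carrier M \<Longrightarrow> a \<odot>\<^bsub>M\<^esub> z = \<zero>\<^bsub>M\<^esub> \<Longrightarrow> z = \<zero>\<^bsub>M\<^esub>"
    and a: "a \<in> carrier R" and xy: "x \<in> carrier M" "y \<in> carrier M" "a \<odot>\<^bsub>M\<^esub> x = a \<odot>\<^bsub>M\<^esub> y"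
  shows "x = y"
proof -
  have "a \<odot>\<^bsub>M\<^esub> (x \<oplus>\<^bsub>M\<^esub> \<ominus>\<^bsub>M\<^esub> y) = \<zero>\<^bsub>M\<^esub>"
    using a xy by (simp add: smult_r_distr smult_uminus_right M.r_neg)
  then have "x \<oplus>\<^bsub>M\<^esub> \<ominus>\<^bsub>M\<^esub> y = \<zero>\<^bsub>M\<^esub>" using kernel xy by simp
  then show ?thesis using M.minus_equality[of x "\<ominus>\<^bsub>M\<^esub> y"] xy by simp
qed

end

lemma lmod_hom_zero:
  assumes "left_module R M" "left_module R N" "h \<in> lmod_hom R M N"
  shows "h \<zero>\<^bsub>M\<^esub> = \<zero>\<^bsub>N\<^esub>"
proof -
  interpret M: left_module R M by fact
  interpret N: left_module R N by fact
  show ?thesis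
    using lmod_hom_smult[OF assms(3), of "\<zero>\<^bsub>R\<^esub>" "\<zero>\<^bsub>M\<^esub>"] lmod_hom_closed[OF assms(3)]
    by (simp add: M.smult_zero_left N.smult_zero_left)
qed

lemma submoduleD:
  assumes "submodule N R M"
  shows "N \<subseteq> carrier M" "\<zero>\<^bsub>M\<^esub> \<in> N" "r \<in> carrier R \<Longrightarrow> x \<in> N \<Longrightarrow> r \<odot>\<^bsub>M\<^esub> x \<in> N"
proof -
  interpret submodule N R M by fact
  show "N \<subseteq> carrier M" "\<zero>\<^bsub>M\<^esub> \<in> N" "r \<in> carrier R \<Longrightarrow> x \<in> N \<Longrightarrow> r \<odot>\<^bsub>M\<^esub> x \<in> N"
    using subset one_closed smult_closed by simp_all
qed

section \<open>Baer's criterion\<close>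

definition left_ideal :: "'r set \<Rightarrow> ('r, 'x) ring_scheme \<Rightarrow> bool" where
  "left_ideal J R \<longleftrightarrow>
    J \<subseteq> carrier R \<and> \<zero>\<^bsub>R\<^esub> \<in> J \<and> (\<forall>x\<in>J. \<forall>y\<in>J. x \<oplus>\<^bsub>R\<^esub> y \<in> J) \<and>
    (\<forall>r\<in>carrier R. \<forall>x\<in>J. r \<otimes>\<^bsub>R\<^esub> x \<in> J)"

definition left_ideal_module :: "('r, 'x) ring_scheme \<Rightarrow> 'r set \<Rightarrow> ('r, 'r) module" where
  "left_ideal_module R J =
    \<lparr>carrier = J, monoid.mult = undefined, one = undefined, ring.zero = \<zero>\<^bsub>R\<^esub>,
     add = ring.add R, module.smult = monoid.mult R\<rparr>"

text \<open>
  A homomorphism into \<open>E\<close> from a submodule of \<open>B\<close>, given by its graph, so that extension of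
  homomorphisms is inclusion of sets and Zorn's lemma for inclusion applies. By linearity, the
  last condition is enough for the graph to be single-valued.
\<close>

definition partial_hom_graph ::
  "('r, 'x) ring_scheme \<Rightarrow> ('r, 'm) module \<Rightarrow> ('r, 'n) module \<Rightarrow> ('m \<times> 'n) set \<Rightarrow> bool" where
  "partial_hom_graph R B E G \<longleftrightarrow>
    G \<subseteq> carrier B \<times> carrier E \<and> (\<zero>\<^bsub>B\<^esub>, \<zero>\<^bsub>E\<^esub>) \<in> G \<and>
    (\<forall>x u y v. (x, u) \<in> G \<longrightarrow> (y, v) \<in> G \<longrightarrow> (x \<oplus>\<^bsub>B\<^esub> y, u \<oplus>\<^bsub>E\<^esub> v) \<in> G) \<and>
    (\<forall>r x u. r \<in> carrier R \<longrightarrow> (x, u) \<in> G \<longrightarrow> (r \<odot>\<^bsub>B\<^esub> x, r \<odot>\<^bsub>E\<^esub> u) \<in> G) \<and>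
    (\<forall>u. (\<zero>\<^bsub>B\<^esub>, u) \<in> G \<longrightarrow> u = \<zero>\<^bsub>E\<^esub>)"

lemma
  assumes "partial_hom_graph R B E G"
  shows partial_hom_graph_carrier: "(x, u) \<in> G \<Longrightarrow> x \<in> carrier B \<and> u \<in> carrier E"
    and partial_hom_graph_zero: "(\<zero>\<^bsub>B\<^esub>, \<zero>\<^bsub>E\<^esub>) \<in> G"
    and partial_hom_graph_add: "(x, u) \<in> G \<Longrightarrow> (y, v) \<in> G \<Longrightarrow> (x \<oplus>\<^bsub>B\<^esub> y, u \<oplus>\<^bsub>E\<^esub> v) \<in> G"
    and partial_hom_graph_smult: "r \<in> carrier R \<Longrightarrow> (x, u) \<in> G \<Longrightarrow> (r \<odot>\<^bsub>B\<^esub> x, r \<odot>\<^bsub>E\<^esub> u) \<in> G"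
    and partial_hom_graph_zero_unique: "(\<zero>\<^bsub>B\<^esub>, u) \<in> G \<Longrightarrow> u = \<zero>\<^bsub>E\<^esub>"
  using assms unfolding partial_hom_graph_def by blast+

lemma partial_hom_graph_unique:
  assumes "left_module R B" "left_module R E" and G: "partial_hom_graph R B E G"
    and xu: "(x, u) \<in> G" and xv: "(x, v) \<in> G"
  shows "u = v"
proof -
  interpret B: left_module R B by fact
  interpret E: left_module R E by fact
  note [simp] = partial_hom_graph_carrier[OF G xu] partial_hom_graph_carrier[OF G xv]
  have "(\<ominus>\<^bsub>B\<^esub> x, \<ominus>\<^bsub>E\<^esub> v) \<in> G"
    using partial_hom_graph_smult[OF G _ xv, of "\<ominus>\<^bsub>R\<^esub> \<one>\<^bsub>R\<^esub>"]
    by (simp add: B.smult_minus_one E.smult_minus_one)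
  then have "(\<zero>\<^bsub>B\<^esub>, u \<oplus>\<^bsub>E\<^esub> \<ominus>\<^bsub>E\<^esub> v) \<in> G"
    using partial_hom_graph_add[OF G xu] by (metis B.M.r_neg partial_hom_graph_carrier[OF G xu])
  then have "u \<oplus>\<^bsub>E\<^esub> \<ominus>\<^bsub>E\<^esub> v = \<zero>\<^bsub>E\<^esub>"
    by (rule partial_hom_graph_zero_unique[OF G])
  then show ?thesis
    using E.M.minus_equality[of "u" "\<ominus>\<^bsub>E\<^esub> v"] by simp
qed

text \<open>
  The obstruction to extending a homomorphism \<open>h\<close> with domain \<open>D\<close> to an element \<open>b\<close> is the left
  ideal of all \<open>r\<close> with \<open>r b\<close> in \<open>D\<close>, on which \<open>r \<mapsto> h (r b)\<close> prescribes the action of \<open>r\<close> on the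
  image of \<open>b\<close>. If that map is right multiplication by some \<open>e\<close>, then \<open>b \<mapsto> e\<close> extends \<open>h\<close>.
\<close>

lemma partial_hom_graph_extend:
  assumes B: "left_module R B" and E: "left_module R E"
    and baer: "\<forall>J. left_ideal J R \<longrightarrow> (\<forall>\<phi>\<in>lmod_hom R (left_ideal_module R J) E.
      \<exists>e\<in>carrier E. \<forall>r\<in>J. \<phi> r = r \<odot>\<^bsub>E\<^esub> e)"
    and G: "partial_hom_graph R B E G" and b: "b \<in> carrier B"
  obtains G' where "partial_hom_graph R B E G'" "G \<subseteq> G'" "b \<in> Domain G'"
proof -
  interpret B: left_module R B by fact
  interpret E: left_module R E by fact
  note Gc = partial_hom_graph_carrier[OF G]
  note unique = partial_hom_graph_unique[OF B E G]
  define J where "J = {r \<in> carrier R. r \<odot>\<^bsub>B\<^esub> b \<in> Domain G}"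
  define \<phi> where "\<phi> r = (THE u. (r \<odot>\<^bsub>B\<^esub> b, u) \<in> G)" for r
  have \<phi>_eq: "\<phi> r = u" if "(r \<odot>\<^bsub>B\<^esub> b, u) \<in> G" for r u
    unfolding \<phi>_def using that unique by blast
  have \<phi>_graph: "(r \<odot>\<^bsub>B\<^esub> b, \<phi> r) \<in> G" if "r \<in> J" for r
    using that \<phi>_eq unfolding J_def by blast
  have J_add: "x \<oplus>\<^bsub>R\<^esub> y \<in> J \<and> \<phi> (x \<oplus>\<^bsub>R\<^esub> y) = \<phi> x \<oplus>\<^bsub>E\<^esub> \<phi> y" if "x \<in> J" "y \<in> J" for x y
  proof -
    have "((x \<oplus>\<^bsub>R\<^esub> y) \<odot>\<^bsub>B\<^esub> b, \<phi> x \<oplus>\<^bsub>E\<^esub> \<phi> y) \<in> G"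
      using partial_hom_graph_add[OF G \<phi>_graph[OF that(1)] \<phi>_graph[OF that(2)]] that b
      by (simp add: J_def B.smult_l_distr)
    with \<phi>_eq[OF this] that show ?thesis by (auto simp: J_def)
  qed
  have J_mult: "r \<otimes>\<^bsub>R\<^esub> x \<in> J \<and> \<phi> (r \<otimes>\<^bsub>R\<^esub> x) = r \<odot>\<^bsub>E\<^esub> \<phi> x" if "r \<in> carrier R" "x \<in> J" for r x
  proof -
    have "((r \<otimes>\<^bsub>R\<^esub> x) \<odot>\<^bsub>B\<^esub> b, r \<odot>\<^bsub>E\<^esub> \<phi> x) \<in> G"
      using partial_hom_graph_smult[OF G that(1) \<phi>_graph[OF that(2)]] that b
      by (simp add: J_def B.smult_assoc)
    with \<phi>_eq[OF this] that show ?thesis by (auto simp: J_def)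
  qed
  have "left_ideal J R"
    unfolding left_ideal_def
  proof (intro conjI)
    show "J \<subseteq> carrier R" by (auto simp: J_def)
    show "\<zero>\<^bsub>R\<^esub> \<in> J"
      using partial_hom_graph_zero[OF G] b by (auto simp: J_def B.smult_zero_left)
  qed (use J_add J_mult in blast)+
  moreover have "\<phi> \<in> lmod_hom R (left_ideal_module R J) E"
    using \<phi>_graph Gc J_add J_mult by (intro lmod_homI) (auto simp: left_ideal_module_def)
  ultimately have "\<exists>e\<in>carrier E. \<forall>r\<in>J. \<phi> r = r \<odot>\<^bsub>E\<^esub> e"
    using baer by blast
  then obtain e where e: "e \<in> carrier E" and \<phi>_e: "\<And>r. r \<in> J \<Longrightarrow> \<phi> r = r \<odot>\<^bsub>E\<^esub> e"
    by blast
  define G' where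
    "G' = {(x \<oplus>\<^bsub>B\<^esub> r \<odot>\<^bsub>B\<^esub> b, u \<oplus>\<^bsub>E\<^esub> r \<odot>\<^bsub>E\<^esub> e) | x u r. (x, u) \<in> G \<and> r \<in> carrier R}"
  have G'I: "(x \<oplus>\<^bsub>B\<^esub> r \<odot>\<^bsub>B\<^esub> b, u \<oplus>\<^bsub>E\<^esub> r \<odot>\<^bsub>E\<^esub> e) \<in> G'" if "(x, u) \<in> G" "r \<in> carrier R" for x u r
    using that by (auto simp: G'_def)
  have G_G': "(x, u) \<in> G'" if "(x, u) \<in> G" for x u
    using G'I[OF that, of "\<zero>\<^bsub>R\<^esub>"] Gc[OF that] b e
    by (simp add: B.smult_zero_left E.smult_zero_left)
  have "partial_hom_graph R B E G'"
    unfolding partial_hom_graph_def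
  proof (intro conjI allI impI)
    show "G' \<subseteq> carrier B \<times> carrier E"
      using Gc b e by (auto simp: G'_def)
    show "(\<zero>\<^bsub>B\<^esub>, \<zero>\<^bsub>E\<^esub>) \<in> G'"
      by (rule G_G'[OF partial_hom_graph_zero[OF G]])
  next
    fix x u y v assume "(x, u) \<in> G'" "(y, v) \<in> G'"
    then obtain x' u' r y' v' s where *: "(x', u') \<in> G" "(y', v') \<in> G"
        "r \<in> carrier R" "s \<in> carrier R"
      "x = x' \<oplus>\<^bsub>B\<^esub> r \<odot>\<^bsub>B\<^esub> b" "u = u' \<oplus>\<^bsub>E\<^esub> r \<odot>\<^bsub>E\<^esub> e"
      "y = y' \<oplus>\<^bsub>B\<^esub> s \<odot>\<^bsub>B\<^esub> b" "v = v' \<oplus>\<^bsub>E\<^esub> s \<odot>\<^bsub>E\<^esub> e"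
      by (auto simp: G'_def)
    have "x \<oplus>\<^bsub>B\<^esub> y = (x' \<oplus>\<^bsub>B\<^esub> y') \<oplus>\<^bsub>B\<^esub> (r \<oplus>\<^bsub>R\<^esub> s) \<odot>\<^bsub>B\<^esub> b"
      "u \<oplus>\<^bsub>E\<^esub> v = (u' \<oplus>\<^bsub>E\<^esub> v') \<oplus>\<^bsub>E\<^esub> (r \<oplus>\<^bsub>R\<^esub> s) \<odot>\<^bsub>E\<^esub> e"
      using * Gc[OF *(1)] Gc[OF *(2)] b e
      by (simp_all add: B.smult_l_distr E.smult_l_distr B.M.a_ac E.M.a_ac)
    then show "(x \<oplus>\<^bsub>B\<^esub> y, u \<oplus>\<^bsub>E\<^esub> v) \<in> G'"
      using G'I[OF partial_hom_graph_add[OF G *(1,2)], of "r \<oplus>\<^bsub>R\<^esub> s"] *(3,4) by simp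
  next
    fix s x u assume s: "s \<in> carrier R" and "(x, u) \<in> G'"
    then obtain x' u' r where *: "(x', u') \<in> G" "r \<in> carrier R"
      "x = x' \<oplus>\<^bsub>B\<^esub> r \<odot>\<^bsub>B\<^esub> b" "u = u' \<oplus>\<^bsub>E\<^esub> r \<odot>\<^bsub>E\<^esub> e"
      by (auto simp: G'_def)
    have "s \<odot>\<^bsub>B\<^esub> x = s \<odot>\<^bsub>B\<^esub> x' \<oplus>\<^bsub>B\<^esub> (s \<otimes>\<^bsub>R\<^esub> r) \<odot>\<^bsub>B\<^esub> b"
      "s \<odot>\<^bsub>E\<^esub> u = s \<odot>\<^bsub>E\<^esub> u' \<oplus>\<^bsub>E\<^esub> (s \<otimes>\<^bsub>R\<^esub> r) \<odot>\<^bsub>E\<^esub> e"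
      using * Gc[OF *(1)] b e s
      by (simp_all add: B.smult_r_distr E.smult_r_distr B.smult_assoc E.smult_assoc)
    then show "(s \<odot>\<^bsub>B\<^esub> x, s \<odot>\<^bsub>E\<^esub> u) \<in> G'"
      using G'I[OF partial_hom_graph_smult[OF G s *(1)], of "s \<otimes>\<^bsub>R\<^esub> r"] *(2) s by simp
  next
    fix w assume "(\<zero>\<^bsub>B\<^esub>, w) \<in> G'"
    then obtain x u r where *: "(x, u) \<in> G" "r \<in> carrier R"
      "x \<oplus>\<^bsub>B\<^esub> r \<odot>\<^bsub>B\<^esub> b = \<zero>\<^bsub>B\<^esub>" "w = u \<oplus>\<^bsub>E\<^esub> r \<odot>\<^bsub>E\<^esub> e"
      unfolding G'_def by auto
    note xu [simp] = Gc[OF *(1), THEN conjunct1] Gc[OF *(1), THEN conjunct2]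
    have rb [simp]: "r \<odot>\<^bsub>B\<^esub> b \<in> carrier B" using * b by simp
    have "\<ominus>\<^bsub>B\<^esub> x = r \<odot>\<^bsub>B\<^esub> b"
      using *(3) B.M.minus_equality[of "r \<odot>\<^bsub>B\<^esub> b" x] by (simp add: B.M.a_comm)
    then have "(r \<odot>\<^bsub>B\<^esub> b, \<ominus>\<^bsub>E\<^esub> u) \<in> G"
      using partial_hom_graph_smult[OF G _ *(1), of "\<ominus>\<^bsub>R\<^esub> \<one>\<^bsub>R\<^esub>"]
      by (simp add: B.smult_minus_one E.smult_minus_one)
    then have "\<phi> r = \<ominus>\<^bsub>E\<^esub> u" "r \<in> J"
      using \<phi>_eq *(2) unfolding J_def by blast+
    then show "w = \<zero>\<^bsub>E\<^esub>"
      using \<phi>_e *(4) by (metis E.M.r_neg xu(2))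
  qed
  moreover have "b \<in> Domain G'"
    using G'I[OF partial_hom_graph_zero[OF G], of "\<one>\<^bsub>R\<^esub>"] b by (auto simp: Domain_unfold)
  moreover have "G \<subseteq> G'"
    using G_G' by (rule subrelI)
  ultimately show ?thesis using that by blast
qed

text \<open>
  Baer's criterion: a maximal extension of the given homomorphism, which exists by Zorn's lemma,
  is defined everywhere because it could otherwise be extended to one more element.
\<close>

theorem baer_criterion:
  fixes E :: "('r, 'm) module" and R :: "('r, 'x) ring_scheme"
  assumes E: "left_module R E"
    and baer: "\<forall>J. left_ideal J R \<longrightarrow> (\<forall>\<phi>\<in>lmod_hom R (left_ideal_module R J) E.
      \<exists>e\<in>carrier E. \<forall>r\<in>J. \<phi> r = r \<odot>\<^bsub>E\<^esub> e)"
  shows "injective_left_module TYPE('a) TYPE('b) R E"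
  unfolding injective_left_module_def
proof (intro conjI E allI impI, elim conjE)
  fix A :: "('r, 'a) module" and B :: "('r, 'b) module" and i g
  assume A: "left_module R A" and B: "left_module R B" and i: "i \<in> lmod_hom R A B"
    and inj: "inj_on i (carrier A)" and g: "g \<in> lmod_hom R A E"
  interpret A: left_module R A by fact
  interpret B: left_module R B by fact
  interpret E: left_module R E by fact
  define G0 where "G0 = (\<lambda>x. (i x, g x)) ` carrier A"
  have G0_add: "(x \<oplus>\<^bsub>B\<^esub> y, u \<oplus>\<^bsub>E\<^esub> v) \<in> G0" if "(x, u) \<in> G0" "(y, v) \<in> G0" for x u y v
    using that unfolding G0_def
    by (auto simp: lmod_hom_add[OF i, symmetric] lmod_hom_add[OF g, symmetric])
  have G0_smult: "(r \<odot>\<^bsub>B\<^esub> x, r \<odot>\<^bsub>E\<^esub> u) \<in> G0" if "(x, u) \<in> G0" "r \<in> carrier R" for r x u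
    using that unfolding G0_def
    by (auto simp: lmod_hom_smult[OF i, symmetric] lmod_hom_smult[OF g, symmetric])
  have G0_zero: "(\<zero>\<^bsub>B\<^esub>, \<zero>\<^bsub>E\<^esub>) \<in> G0"
    using lmod_hom_zero[OF A B i] lmod_hom_zero[OF A E g] by (force simp: G0_def)
  have zero_unique: "x = \<zero>\<^bsub>A\<^esub>" if "x \<in> carrier A" "i x = \<zero>\<^bsub>B\<^esub>" for x
    using inj_onD[OF inj, of x "\<zero>\<^bsub>A\<^esub>"] that lmod_hom_zero[OF A B i] by simp
  have G0: "partial_hom_graph R B E G0"
    unfolding partial_hom_graph_def
  proof (intro conjI allI impI)
    show "G0 \<subseteq> carrier B \<times> carrier E"
      by (auto simp: G0_def lmod_hom_closed[OF i] lmod_hom_closed[OF g])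
    show "u = \<zero>\<^bsub>E\<^esub>" if "(\<zero>\<^bsub>B\<^esub>, u) \<in> G0" for u
      using that zero_unique lmod_hom_zero[OF A E g] unfolding G0_def by fastforce
  qed (use G0_add G0_smult G0_zero in blast)+
  have union: "partial_hom_graph R B E (\<Union>C)"
    if "C \<noteq> {}" and chain: "subset.chain {G. partial_hom_graph R B E G \<and> G0 \<subseteq> G} C" for C
  proof -
    have C: "partial_hom_graph R B E G" if "G \<in> C" for G
      using chain that by (auto simp: subset.chain_def)
    show ?thesis
      unfolding partial_hom_graph_def
    proof (intro conjI allI impI)
      fix x u y v assume "(x, u) \<in> \<Union>C" "(y, v) \<in> \<Union>C"
      then obtain G G' where G: "G \<in> C" "(x, u) \<in> G" and G': "G' \<in> C" "(y, v) \<in> G'" by blast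
      then have "G \<subseteq> G' \<or> G' \<subseteq> G" using chain unfolding subset.chain_def by blast
      then obtain H where "H \<in> C" "(x, u) \<in> H" "(y, v) \<in> H" using G G' by blast
      then show "(x \<oplus>\<^bsub>B\<^esub> y, u \<oplus>\<^bsub>E\<^esub> v) \<in> \<Union>C" using partial_hom_graph_add[OF C] by blast
    qed (use C \<open>C \<noteq> {}\<close> in \<open>auto dest: partial_hom_graph_carrier partial_hom_graph_zero
           partial_hom_graph_smult partial_hom_graph_zero_unique\<close>)
  qed
  define \<H> where "\<H> = {G. partial_hom_graph R B E G \<and> G0 \<subseteq> G}"
  have "\<exists>G\<in>\<H>.
      \<forall>G'\<in>\<H>. G \<subseteq> G' \<longrightarrow> G' = G"
  proof (rule subset_Zorn_nonempty)
    show "\<H> \<noteq> {}" using G0 by (auto simp: \<H>_def)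
    show "\<Union>C \<in> \<H>"
      if "C \<noteq> {}" "subset.chain \<H> C" for C
    proof -
      have "G0 \<subseteq> \<Union>C" using that unfolding subset.chain_def \<H>_def by blast
      then show ?thesis using union that unfolding \<H>_def by blast
    qed
  qed
  then obtain G where "G \<in> \<H>" and G_max: "\<forall>G'\<in>\<H>. G \<subseteq> G' \<longrightarrow> G' = G"
    by (rule bexE)
  then have G: "partial_hom_graph R B E G" and "G0 \<subseteq> G"
    by (simp_all add: \<H>_def)
  have maximal: "G' = G" if "partial_hom_graph R B E G'" "G \<subseteq> G'" for G'
    using G_max \<open>G0 \<subseteq> G\<close> that unfolding \<H>_def by blast
  note unique = partial_hom_graph_unique[OF B E G]
  have "b \<in> Domain G" if "b \<in> carrier B" for b
    using partial_hom_graph_extend[OF B E baer G that] maximal by metis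
  then have total: "\<exists>!u. (b, u) \<in> G" if "b \<in> carrier B" for b
    using that unique by (auto simp: Domain_unfold)
  define h where "h b = (THE u. (b, u) \<in> G)" for b
  have h_eq: "h b = u" if "(b, u) \<in> G" for b u
    unfolding h_def using that unique by blast
  have h_graph: "(b, h b) \<in> G" if "b \<in> carrier B" for b
    using total[OF that] h_eq by blast
  have "h \<in> lmod_hom R B E"
    using h_graph partial_hom_graph_carrier[OF G]
    by (intro lmod_homI h_eq partial_hom_graph_add[OF G] partial_hom_graph_smult[OF G]) blast+
  moreover have "h (i x) = g x" if "x \<in> carrier A" for x
    using \<open>G0 \<subseteq> G\<close> that by (intro h_eq) (auto simp: G0_def)
  ultimately show "\<exists>h\<in>lmod_hom R B E. \<forall>x\<in>carrier A. h (i x) = g x" by blast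
qed

section \<open>Cyclic modules\<close>

context
  fixes R :: "('r, 'x) ring_scheme" (structure) and J :: "'r set"
  assumes R: "ring R" and J: "left_ideal J R"
begin

interpretation ring R by (rule R)

lemma left_ideal_subgroup: "abelian_subgroup J R"
proof (intro abelian_subgroupI3 additive_subgroup.intro)
  have "\<ominus> x \<in> J" if "x \<in> J" for x
  proof -
    have "x \<in> carrier R" "(\<ominus> \<one>) \<otimes> x \<in> J" using J that by (auto simp: left_ideal_def)
    then show ?thesis by (simp add: l_minus)
  qed
  then show "subgroup J (add_monoid R)"
    using J by (intro add.subgroupI) (auto simp: left_ideal_def a_inv_def)
  show "abelian_group R" by (rule is_abelian_group)
qed

interpretation J: abelian_subgroup J R by (rule left_ideal_subgroup)

lemma ring_mod_left_ideal_carrier: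
  "carrier (ring_mod_left_ideal R J) = {J +> x | x. x \<in> carrier R}"
  by (auto simp: ring_mod_left_ideal_def A_RCOSETS_def')

lemma ring_mod_left_ideal_zero: "\<zero>\<^bsub>ring_mod_left_ideal R J\<^esub> = J +> \<zero>"
  using a_coset_add_zero[of J] J.a_subset by (simp add: ring_mod_left_ideal_def)

lemma ring_mod_left_ideal_add:
  "x \<in> carrier R \<Longrightarrow> y \<in> carrier R \<Longrightarrow>
    (J +> x) \<oplus>\<^bsub>ring_mod_left_ideal R J\<^esub> (J +> y) = J +> (x \<oplus> y)"
  by (simp add: ring_mod_left_ideal_def J.a_rcos_sum)

text \<open>
  Representatives of one coset differ by an element of \<open>J\<close>, and left multiplication preserves \<open>J\<close>,
  so all the cosets united by the definition are the same.
\<close>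

lemma ring_mod_left_ideal_smult:
  assumes r: "r \<in> carrier R" and x: "x \<in> carrier R"
  shows "r \<odot>\<^bsub>ring_mod_left_ideal R J\<^esub> (J +> x) = J +> (r \<otimes> x)"
proof -
  have "J +> (r \<otimes> y) = J +> (r \<otimes> x)" if "y \<in> J +> x" for y
  proof -
    obtain j where j: "j \<in> J" "y = j \<oplus> x"
      using \<open>y \<in> J +> x\<close> by (auto simp: a_r_coset_def')
    have jc: "j \<in> carrier R" using j J by (auto simp: left_ideal_def)
    have "r \<otimes> j \<in> J" using j r J by (auto simp: left_ideal_def)
    moreover have "r \<otimes> y = r \<otimes> j \<oplus> r \<otimes> x" using j jc r x by (simp add: r_distr)
    ultimately have "r \<otimes> y \<in> J +> (r \<otimes> x)" by (auto simp: a_r_coset_def')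
    then show ?thesis using J.a_repr_independence' r x by (metis m_closed)
  qed
  moreover have "x \<in> J +> x" using x by (rule J.a_rcos_self)
  ultimately have "(\<Union>y\<in>J +> x. J +> (r \<otimes> y)) = J +> (r \<otimes> x)" by blast
  then show ?thesis by (simp add: ring_mod_left_ideal_def)
qed

lemmas ring_mod_left_ideal_simps = ring_mod_left_ideal_carrier ring_mod_left_ideal_zero
  ring_mod_left_ideal_add ring_mod_left_ideal_smult

lemma left_module_ring_mod_left_ideal: "left_module R (ring_mod_left_ideal R J)"
  (is "left_module R ?Q")
proof (intro left_module.intro left_module_axioms.intro R)
  show "abelian_group ?Q"
  proof (rule abelian_groupI)
    fix S assume "S \<in> carrier ?Q"
    then obtain x where x: "S = J +> x" "x \<in> carrier R" by (auto simp: ring_mod_left_ideal_simps)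
    then have "(J +> \<ominus> x) \<oplus>\<^bsub>?Q\<^esub> S = \<zero>\<^bsub>?Q\<^esub>" by (simp add: ring_mod_left_ideal_simps l_neg)
    moreover have "J +> \<ominus> x \<in> carrier ?Q" using x by (auto simp: ring_mod_left_ideal_simps)
    ultimately show "\<exists>T\<in>carrier ?Q. T \<oplus>\<^bsub>?Q\<^esub> S = \<zero>\<^bsub>?Q\<^esub>" by blast
  qed (auto simp: ring_mod_left_ideal_simps a_ac)
qed (auto simp: ring_mod_left_ideal_simps l_distr r_distr m_assoc)

end

section \<open>Direct limits\<close>

locale directed_system =
  fixes R :: "('r, 'x) ring_scheme" and I :: "'i::order set"
    and M :: "'i \<Rightarrow> ('r, 'm) module" and \<psi> :: "'i \<Rightarrow> 'i \<Rightarrow> 'm \<Rightarrow> 'm"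
  assumes nonempty: "I \<noteq> {}"
    and directed: "i \<in> I \<Longrightarrow> j \<in> I \<Longrightarrow> \<exists>k\<in>I. i \<le> k \<and> j \<le> k"
    and module: "i \<in> I \<Longrightarrow> left_module R (M i)"
    and hom: "i \<in> I \<Longrightarrow> j \<in> I \<Longrightarrow> i \<le> j \<Longrightarrow> \<psi> i j \<in> lmod_hom R (M i) (M j)"
    and trans_refl: "i \<in> I \<Longrightarrow> x \<in> carrier (M i) \<Longrightarrow> \<psi> i i x = x"
    and trans_trans: "i \<in> I \<Longrightarrow> j \<in> I \<Longrightarrow> k \<in> I \<Longrightarrow> i \<le> j \<Longrightarrow> j \<le> k \<Longrightarrow>
      x \<in> carrier (M i) \<Longrightarrow> \<psi> j k (\<psi> i j x) = \<psi> i k x"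
begin

abbreviation lim_mod :: "('r, ('i \<times> 'm) set) module" where "lim_mod \<equiv> direct_limit I M \<psi>"
abbreviation incl :: "'i \<Rightarrow> 'm \<Rightarrow> ('i \<times> 'm) set" ("\<iota>") where "\<iota> \<equiv> dlim_incl I M \<psi>"

lemma trans_closed:
  "i \<in> I \<Longrightarrow> j \<in> I \<Longrightarrow> i \<le> j \<Longrightarrow> x \<in> carrier (M i) \<Longrightarrow> \<psi> i j x \<in> carrier (M j)"
  using lmod_hom_closed[OF hom] by blast

lemma equiv_dlim_rel: "equiv (SIGMA i:I. carrier (M i)) (dlim_rel I M \<psi>)"
proof (rule equivI)
  show "dlim_rel I M \<psi> \<subseteq> (SIGMA i:I. carrier (M i)) \<times> (SIGMA i:I. carrier (M i))"
    by (auto simp: dlim_rel_def)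
  show "refl_on (SIGMA i:I. carrier (M i)) (dlim_rel I M \<psi>)"
    by (auto simp: refl_on_def dlim_rel_def)
  show "sym (dlim_rel I M \<psi>)"
    by (rule symI) (force simp: dlim_rel_def)
  show "trans (dlim_rel I M \<psi>)"
  proof (rule transI)
    fix S T W assume "(S, T) \<in> dlim_rel I M \<psi>" "(T, W) \<in> dlim_rel I M \<psi>"
    then obtain i x j y k z m n where *: "S = (i, x)" "T = (j, y)" "W = (k, z)"
      "i \<in> I" "j \<in> I" "k \<in> I" "x \<in> carrier (M i)" "y \<in> carrier (M j)" "z \<in> carrier (M k)"
      "m \<in> I" "i \<le> m" "j \<le> m" "\<psi> i m x = \<psi> j m y" "n \<in> I" "j \<le> n" "k \<le> n" "\<psi> j n y = \<psi> k n z"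
      by (auto simp: dlim_rel_def)
    obtain l where l: "l \<in> I" "m \<le> l" "n \<le> l" using directed * by blast
    have "\<psi> i l x = \<psi> m l (\<psi> j m y)" using * l trans_trans[of i m l x] by simp
    also have "\<dots> = \<psi> j l y" using * l by (simp add: trans_trans)
    also have "\<dots> = \<psi> n l (\<psi> k n z)" using * l trans_trans[of j n l y] by simp
    also have "\<dots> = \<psi> k l z" using * l by (simp add: trans_trans)
    finally have "\<psi> i l x = \<psi> k l z" .
    moreover have "i \<le> l" "k \<le> l" using * l by (auto intro: order_trans)
    ultimately show "(S, W) \<in> dlim_rel I M \<psi>" using * l by (auto simp: dlim_rel_def)
  qed
qed

lemma incl_eq_iff:
  assumes "i \<in> I" "j \<in> I" "x \<in> carrier (M i)" "y \<in> carrier (M j)"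
  shows "\<iota> i x = \<iota> j y \<longleftrightarrow> (\<exists>k\<in>I. i \<le> k \<and> j \<le> k \<and> \<psi> i k x = \<psi> j k y)"
  using eq_equiv_class_iff[OF equiv_dlim_rel, of "(i, x)" "(j, y)"] assms
  unfolding dlim_incl_def by (auto simp: dlim_rel_def)

lemma incl_trans:
  assumes "i \<in> I" "j \<in> I" "i \<le> j" "x \<in> carrier (M i)"
  shows "\<iota> j (\<psi> i j x) = \<iota> i x"
  using assms trans_closed[of i j x] trans_refl
  by (subst incl_eq_iff) (auto intro!: bexI[of _ j])

lemma carrier_lim: "carrier lim_mod = {\<iota> i x | i x. i \<in> I \<and> x \<in> carrier (M i)}"
  by (auto simp: direct_limit_def quotient_def dlim_incl_def)

lemma incl_closed: "i \<in> I \<Longrightarrow> x \<in> carrier (M i) \<Longrightarrow> \<iota> i x \<in> carrier lim_mod"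
  by (auto simp: carrier_lim)

lemma mem_inclD:
  assumes "(j, y) \<in> \<iota> i x"
  shows "j \<in> I" "y \<in> carrier (M j)" "\<exists>k\<in>I. i \<le> k \<and> j \<le> k \<and> \<psi> i k x = \<psi> j k y"
  using assms by (auto simp: dlim_incl_def dlim_rel_def)

lemma mem_incl_self: "i \<in> I \<Longrightarrow> x \<in> carrier (M i) \<Longrightarrow> (i, x) \<in> \<iota> i x"
  by (auto simp: dlim_incl_def dlim_rel_def)

lemma incl_smult:
  assumes "i \<in> I" "x \<in> carrier (M i)" and r: "r \<in> carrier R"
  shows "r \<odot>\<^bsub>lim_mod\<^esub> \<iota> i x = \<iota> i (r \<odot>\<^bsub>M i\<^esub> x)"
proof -
  have *: "\<iota> j (r \<odot>\<^bsub>M j\<^esub> y) = \<iota> i (r \<odot>\<^bsub>M i\<^esub> x)" if "(j, y) \<in> \<iota> i x" for j y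
  proof -
    note j = mem_inclD[OF that]
    then obtain k where k: "k \<in> I" "i \<le> k" "j \<le> k" "\<psi> i k x = \<psi> j k y" by blast
    then have "\<psi> j k (r \<odot>\<^bsub>M j\<^esub> y) = \<psi> i k (r \<odot>\<^bsub>M i\<^esub> x)"
      using j assms by (simp add: lmod_hom_smult[OF hom])
    then show ?thesis
      using j k assms by (subst incl_eq_iff) (auto intro!: left_module.smult_closed[OF module])
  qed
  have "r \<odot>\<^bsub>lim_mod\<^esub> \<iota> i x = (\<Union>(j, y)\<in>\<iota> i x. \<iota> j (r \<odot>\<^bsub>M j\<^esub> y))"
    by (simp add: direct_limit_def)
  also have "\<dots> = \<iota> i (r \<odot>\<^bsub>M i\<^esub> x)"
    using * mem_incl_self[OF assms(1,2)] by blast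
  finally show ?thesis .
qed

text \<open>
  The sum of two classes is a union over all representatives and all common stages. All the sets
  in this union coincide, as is seen by moving to a stage beyond which the representatives agree.
\<close>

lemma incl_add:
  assumes i: "i \<in> I" "x \<in> carrier (M i)" "y \<in> carrier (M i)"
  shows "\<iota> i x \<oplus>\<^bsub>lim_mod\<^esub> \<iota> i y = \<iota> i (x \<oplus>\<^bsub>M i\<^esub> y)"
proof -
  have add_closed: "u \<oplus>\<^bsub>M j\<^esub> v \<in> carrier (M j)"
    if "j \<in> I" "u \<in> carrier (M j)" "v \<in> carrier (M j)" for j u v
  proof -
    interpret left_module R "M j" using that by (simp add: module)
    show ?thesis using that by (intro M.add.m_closed)
  qed
  have *: "\<iota> n (\<psi> j n u \<oplus>\<^bsub>M n\<^esub> \<psi> k n v) = \<iota> i (x \<oplus>\<^bsub>M i\<^esub> y)"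
    if u: "(j, u) \<in> \<iota> i x" and v: "(k, v) \<in> \<iota> i y" and n: "n \<in> I" "j \<le> n" "k \<le> n" for j u k v n
  proof -
    note j = mem_inclD[OF u] and k = mem_inclD[OF v]
    from j obtain p where p: "p \<in> I" "i \<le> p" "j \<le> p" "\<psi> i p x = \<psi> j p u" by blast
    from k obtain q where q: "q \<in> I" "i \<le> q" "k \<le> q" "\<psi> i q y = \<psi> k q v" by blast
    obtain l where l: "l \<in> I" "p \<le> l" "q \<le> l" using directed p q by blast
    obtain m where m: "m \<in> I" "l \<le> m" "n \<le> m" using directed l n by blast
    have pm: "p \<le> m" "q \<le> m" "i \<le> m" using l m p by (auto intro: order_trans)
    have x_u: "\<psi> j m u = \<psi> i m x"
      using j p pm m i by (metis trans_trans)
    have y_v: "\<psi> k m v = \<psi> i m y"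
      using k q pm m i by (metis trans_trans)
    have "\<psi> n m (\<psi> j n u \<oplus>\<^bsub>M n\<^esub> \<psi> k n v) = \<psi> j m u \<oplus>\<^bsub>M m\<^esub> \<psi> k m v"
      using j k n m by (simp add: lmod_hom_add[OF hom] trans_closed trans_trans)
    also have "\<dots> = \<psi> i m (x \<oplus>\<^bsub>M i\<^esub> y)"
      using i m pm x_u y_v by (simp add: lmod_hom_add[OF hom])
    finally show ?thesis
      using i j k n m pm by (subst incl_eq_iff) (auto intro!: add_closed trans_closed)
  qed
  define add_at where "add_at p q = (\<Union>n\<in>{n \<in> I. fst p \<le> n \<and> fst q \<le> n}.
    \<iota> n (\<psi> (fst p) n (snd p) \<oplus>\<^bsub>M n\<^esub> \<psi> (fst q) n (snd q)))" for p q
  have add_at: "add_at p q = \<iota> i (x \<oplus>\<^bsub>M i\<^esub> y)" if pq: "p \<in> \<iota> i x" "q \<in> \<iota> i y" for p q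
  proof -
    obtain j u k v where jk: "p = (j, u)" "q = (k, v)" by fastforce
    obtain n where "n \<in> I" "j \<le> n" "k \<le> n"
      using directed mem_inclD(1) pq unfolding jk by blast
    then show ?thesis
      using *[of j u k v] pq unfolding add_at_def jk fst_conv snd_conv by blast
  qed
  have "\<iota> i x \<oplus>\<^bsub>lim_mod\<^esub> \<iota> i y = (\<Union>p\<in>\<iota> i x. \<Union>q\<in>\<iota> i y. add_at p q)"
    by (simp add: direct_limit_def add_at_def case_prod_unfold)
  also have "\<dots> = \<iota> i (x \<oplus>\<^bsub>M i\<^esub> y)"
    using mem_incl_self[OF i(1,2)] mem_incl_self[OF i(1,3)] add_at by blast
  finally show ?thesis .
qed

lemma incl_zero:
  assumes "i \<in> I"
  shows "\<iota> i \<zero>\<^bsub>M i\<^esub> = \<zero>\<^bsub>lim_mod\<^esub>"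
proof -
  have zero_closed: "\<zero>\<^bsub>M j\<^esub> \<in> carrier (M j)" if "j \<in> I" for j
  proof -
    interpret left_module R "M j" using that by (simp add: module)
    show ?thesis by simp
  qed
  have "\<iota> j \<zero>\<^bsub>M j\<^esub> = \<iota> i \<zero>\<^bsub>M i\<^esub>" if j: "j \<in> I" for j
  proof -
    obtain k where k: "k \<in> I" "i \<le> k" "j \<le> k" using directed assms j by blast
    have "\<psi> j k \<zero>\<^bsub>M j\<^esub> = \<psi> i k \<zero>\<^bsub>M i\<^esub>"
      using lmod_hom_zero[OF module module hom] assms j k by simp
    then show ?thesis using assms j k by (subst incl_eq_iff) (auto intro: zero_closed)
  qed
  then have "(\<Union>j\<in>I. \<iota> j \<zero>\<^bsub>M j\<^esub>) = \<iota> i \<zero>\<^bsub>M i\<^esub>" using assms by blast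
  then show ?thesis by (simp add: direct_limit_def)
qed

lemma lim_cases:
  assumes "S \<in> carrier lim_mod"
  obtains i x where "i \<in> I" "x \<in> carrier (M i)" "S = \<iota> i x"
  using assms by (auto simp: carrier_lim)

lemma lim_cases_above:
  assumes "S \<in> carrier lim_mod" "i \<in> I"
  obtains j x where "j \<in> I" "i \<le> j" "x \<in> carrier (M j)" "S = \<iota> j x"
proof -
  obtain k x where k: "k \<in> I" "x \<in> carrier (M k)" "S = \<iota> k x" using assms(1) by (rule lim_cases)
  obtain j where j: "j \<in> I" "i \<le> j" "k \<le> j" using directed assms k by blast
  show thesis
    using that[OF j(1,2) trans_closed[OF k(1) j(1,3) k(2)]] incl_trans[OF k(1) j(1,3) k(2)] k by simp
qed

text \<open>
  Finitely many elements of the limit come from one common stage, so the module axioms can be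
  checked there.
\<close>

lemma lim_cases2:
  assumes "S \<in> carrier lim_mod" "T \<in> carrier lim_mod"
  obtains i x y where "i \<in> I" "x \<in> carrier (M i)" "y \<in> carrier (M i)" "S = \<iota> i x" "T = \<iota> i y"
proof -
  obtain j x where j: "j \<in> I" "x \<in> carrier (M j)" "S = \<iota> j x" using assms(1) by (rule lim_cases)
  obtain i y where i: "i \<in> I" "j \<le> i" "y \<in> carrier (M i)" "T = \<iota> i y"
    using assms(2) j(1) by (rule lim_cases_above)
  show thesis
    using that[OF i(1) trans_closed[OF j(1) i(1,2) j(2)] i(3)] incl_trans[OF j(1) i(1,2) j(2)] i j
    by simp
qed

lemma lim_cases3:
  assumes "S \<in> carrier lim_mod" "T \<in> carrier lim_mod" "W \<in> carrier lim_mod"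
  obtains i x y z where "i \<in> I" "x \<in> carrier (M i)" "y \<in> carrier (M i)" "z \<in> carrier (M i)"
    "S = \<iota> i x" "T = \<iota> i y" "W = \<iota> i z"
proof -
  obtain j x y where j: "j \<in> I" "x \<in> carrier (M j)" "y \<in> carrier (M j)" "S = \<iota> j x" "T = \<iota> j y"
    using assms(1,2) by (rule lim_cases2)
  obtain i z where i: "i \<in> I" "j \<le> i" "z \<in> carrier (M i)" "W = \<iota> i z"
    using assms(3) j(1) by (rule lim_cases_above)
  show thesis
    using that[OF i(1) trans_closed[OF j(1) i(1,2) j(2)] trans_closed[OF j(1) i(1,2) j(3)] i(3)]
      incl_trans[OF j(1) i(1,2) j(2)] incl_trans[OF j(1) i(1,2) j(3)] i j by simp
qed

lemma left_module_lim: "left_module R lim_mod"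
proof (intro left_module.intro left_module_axioms.intro)
  obtain i0 where i0: "i0 \<in> I" using nonempty by blast
  show "ring R" using module[OF i0] by (simp add: left_module_def)
  show "abelian_group lim_mod"
  proof (rule abelian_groupI)
    show "\<zero>\<^bsub>lim_mod\<^esub> \<in> carrier lim_mod"
    proof -
      interpret left_module R "M i0" using i0 by (rule module)
      show ?thesis using incl_closed[OF i0 M.zero_closed] incl_zero[OF i0] by simp
    qed
    show "S \<oplus>\<^bsub>lim_mod\<^esub> T \<in> carrier lim_mod" "S \<oplus>\<^bsub>lim_mod\<^esub> T = T \<oplus>\<^bsub>lim_mod\<^esub> S"
      if ST: "S \<in> carrier lim_mod" "T \<in> carrier lim_mod" for S T
    proof -
      obtain i x y where i: "i \<in> I" "x \<in> carrier (M i)" "y \<in> carrier (M i)" "S = \<iota> i x" "T = \<iota> i y"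
        using ST by (rule lim_cases2)
      interpret left_module R "M i" using i by (simp add: module)
      show "S \<oplus>\<^bsub>lim_mod\<^esub> T \<in> carrier lim_mod" "S \<oplus>\<^bsub>lim_mod\<^esub> T = T \<oplus>\<^bsub>lim_mod\<^esub> S"
        using i by (simp_all add: incl_add incl_closed M.a_comm)
    qed
    show "(S \<oplus>\<^bsub>lim_mod\<^esub> T) \<oplus>\<^bsub>lim_mod\<^esub> W = S \<oplus>\<^bsub>lim_mod\<^esub> (T \<oplus>\<^bsub>lim_mod\<^esub> W)"
      if STW: "S \<in> carrier lim_mod" "T \<in> carrier lim_mod" "W \<in> carrier lim_mod" for S T W
      using STW
    proof (rule lim_cases3)
      fix i x y z assume i: "i \<in> I" "x \<in> carrier (M i)" "y \<in> carrier (M i)" "z \<in> carrier (M i)"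
        "S = \<iota> i x" "T = \<iota> i y" "W = \<iota> i z"
      interpret left_module R "M i" using i by (simp add: module)
      show ?thesis using i by (simp add: incl_add M.a_assoc)
    qed
    show "\<zero>\<^bsub>lim_mod\<^esub> \<oplus>\<^bsub>lim_mod\<^esub> S = S" "\<exists>T\<in>carrier lim_mod. T \<oplus>\<^bsub>lim_mod\<^esub> S = \<zero>\<^bsub>lim_mod\<^esub>"
      if S: "S \<in> carrier lim_mod" for S
    proof -
      obtain i x where i: "i \<in> I" "x \<in> carrier (M i)" "S = \<iota> i x" using S by (rule lim_cases)
      interpret left_module R "M i" using i by (simp add: module)
      show "\<zero>\<^bsub>lim_mod\<^esub> \<oplus>\<^bsub>lim_mod\<^esub> S = S"
        using i by (simp add: incl_add flip: incl_zero[OF i(1)])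
      have "\<iota> i (\<ominus>\<^bsub>M i\<^esub> x) \<oplus>\<^bsub>lim_mod\<^esub> S = \<zero>\<^bsub>lim_mod\<^esub>"
        using i by (simp add: incl_add M.l_neg incl_zero)
      then show "\<exists>T\<in>carrier lim_mod. T \<oplus>\<^bsub>lim_mod\<^esub> S = \<zero>\<^bsub>lim_mod\<^esub>"
        using i incl_closed[OF i(1) M.a_inv_closed[OF i(2)]] by blast
    qed
  qed
next
  fix r S assume r: "r \<in> carrier R" and S: "S \<in> carrier lim_mod"
  then obtain i x where i: "i \<in> I" "x \<in> carrier (M i)" "S = \<iota> i x" by (elim lim_cases)
  interpret left_module R "M i" using i by (simp add: module)
  show "r \<odot>\<^bsub>lim_mod\<^esub> S \<in> carrier lim_mod" using i r by (simp add: incl_smult incl_closed)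
next
  fix r s S assume r: "r \<in> carrier R" "s \<in> carrier R" and S: "S \<in> carrier lim_mod"
  then obtain i x where i: "i \<in> I" "x \<in> carrier (M i)" "S = \<iota> i x" by (elim lim_cases)
  interpret left_module R "M i" using i by (simp add: module)
  show "(r \<oplus>\<^bsub>R\<^esub> s) \<odot>\<^bsub>lim_mod\<^esub> S = r \<odot>\<^bsub>lim_mod\<^esub> S \<oplus>\<^bsub>lim_mod\<^esub> s \<odot>\<^bsub>lim_mod\<^esub> S"
    and "(r \<otimes>\<^bsub>R\<^esub> s) \<odot>\<^bsub>lim_mod\<^esub> S = r \<odot>\<^bsub>lim_mod\<^esub> (s \<odot>\<^bsub>lim_mod\<^esub> S)"
    using i r by (simp_all add: incl_smult incl_add smult_l_distr smult_assoc)
next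
  fix r S T assume r: "r \<in> carrier R" and ST: "S \<in> carrier lim_mod" "T \<in> carrier lim_mod"
  from ST obtain i x y where i: "i \<in> I" "x \<in> carrier (M i)" "y \<in> carrier (M i)"
      "S = \<iota> i x" "T = \<iota> i y"
    by (rule lim_cases2)
  interpret left_module R "M i" using i by (simp add: module)
  show "r \<odot>\<^bsub>lim_mod\<^esub> (S \<oplus>\<^bsub>lim_mod\<^esub> T) = r \<odot>\<^bsub>lim_mod\<^esub> S \<oplus>\<^bsub>lim_mod\<^esub> r \<odot>\<^bsub>lim_mod\<^esub> T"
    using i r by (simp add: incl_smult incl_add smult_r_distr)
next
  fix S assume "S \<in> carrier lim_mod"
  then obtain i x where i: "i \<in> I" "x \<in> carrier (M i)" "S = \<iota> i x" by (elim lim_cases)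
  interpret left_module R "M i" using i by (simp add: module)
  show "\<one>\<^bsub>R\<^esub> \<odot>\<^bsub>lim_mod\<^esub> S = S" using i by (simp add: incl_smult)
qed

end

section \<open>Elements and products in the Leavitt path algebra\<close>

lemma free_alg_induct [case_names zero single add]:
  fixes P :: "'k::field free_alg \<Rightarrow> bool"
  assumes zero: "P 0" and single: "\<And>u k. P (Poly_Mapping.single u k)"
    and add: "\<And>p q. P p \<Longrightarrow> P q \<Longrightarrow> P (p + q)"
  shows "P p"
proof -
  have "P (\<Sum>u\<in>S. Poly_Mapping.single u (Poly_Mapping.lookup p u))" for S
    by (induction S rule: infinite_finite_induct) (auto intro: assms)
  moreover have "(\<Sum>u\<in>Poly_Mapping.keys p. Poly_Mapping.single u (Poly_Mapping.lookup p u)) = p"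
    by (rule poly_mapping_eqI) (simp add: lookup_sum lookup_single when_def in_keys_iff)
  ultimately show ?thesis by metis
qed

lemma single_mult_single:
  "(Poly_Mapping.single u k :: 'k::field free_alg) * Poly_Mapping.single u' k' =
    Poly_Mapping.single (u @ u') (k * k')"
  by (simp add: mult_single plus_list_def)

lemma lpa_scalar_add: "lpa_scalar (a + b) = lpa_scalar a + lpa_scalar b"
  by transfer (simp add: single_add toeplitz_cong.refl)

lemma lpa_scalar_mult: "lpa_scalar (a * b) = lpa_scalar a * lpa_scalar b"
  by transfer (simp add: single_mult_single toeplitz_cong.refl)

lemma lpa_scalar_0 [simp]: "lpa_scalar 0 = 0"
  by transfer (simp add: toeplitz_cong.refl)

lemma lpa_scalar_1 [simp]: "lpa_scalar 1 = 1"
  by transfer (simp add: toeplitz_cong.refl flip: zero_list_def)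

text \<open>
  The algebra is generated by the scalars and the six generators.
\<close>

lemma lpa_induct [case_names scalar gen add mult]:
  fixes P :: "'k::field toeplitz_lpa \<Rightarrow> bool"
  assumes scalar: "\<And>k. P (lpa_scalar k)" and gen: "\<And>g. P (lpa_gen g)"
    and add: "\<And>r s. P r \<Longrightarrow> P s \<Longrightarrow> P (r + s)" and mult: "\<And>r s. P r \<Longrightarrow> P s \<Longrightarrow> P (r * s)"
  shows "P r"
proof -
  have single: "P (abs_toeplitz_lpa (Poly_Mapping.single u k))" for u k
  proof (induction u)
    case Nil
    then show ?case using scalar[of k] by (simp add: lpa_scalar.abs_eq)
  next
    case (Cons g u)
    have "abs_toeplitz_lpa (Poly_Mapping.single (g # u) k) =
        lpa_gen g * abs_toeplitz_lpa (Poly_Mapping.single u k)"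
      by (simp add: lpa_gen.abs_eq times_toeplitz_lpa.abs_eq single_mult_single)
    then show ?case using mult[OF gen Cons] by simp
  qed
  have "P (abs_toeplitz_lpa p)" for p
  proof (induction p rule: free_alg_induct)
    case zero
    then show ?case using scalar[of 0] by (simp add: zero_toeplitz_lpa.abs_eq)
  next
    case (add p q)
    then show ?case using assms(3) by (simp flip: plus_toeplitz_lpa.abs_eq)
  qed (rule single)
  then show ?thesis by (metis Quotient_toeplitz_lpa Quotient_abs_rep)
qed

lemma lpa_scalar_commute: "lpa_scalar k * r = r * lpa_scalar k"
proof (induction r rule: lpa_induct)
  case (scalar l)
  then show ?case by (simp add: mult.commute flip: lpa_scalar_mult)
next
  case (gen g)
  then show ?case by transfer (simp add: single_mult_single toeplitz_cong.refl)
next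
  case (add r s)
  then show ?case by (simp add: algebra_simps)
next
  case (mult r s)
  then show ?case by (metis mult.assoc)
qed

lemma lpa_relation:
  assumes "(a, b) \<in> toeplitz_relations"
  shows "abs_toeplitz_lpa a = abs_toeplitz_lpa b"
  using toeplitz_cong.rel[OF assms] by (simp add: toeplitz_lpa.abs_eq_iff)

lemma lpa_gen_mult: "lpa_gen g * lpa_gen h = abs_toeplitz_lpa (word [g, h])"
  by (simp add: lpa_gen.abs_eq times_toeplitz_lpa.abs_eq single_mult_single)

lemma lpa_gen_relations:
  shows "lpa_gen GV + lpa_gen GW = (1 :: 'k::field toeplitz_lpa)"
    and "lpa_gen GV * lpa_gen GW = (0 :: 'k toeplitz_lpa)"
    and "lpa_gen GW * lpa_gen GV = (0 :: 'k toeplitz_lpa)"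
    and "lpa_gen GV * lpa_gen GC = (lpa_gen GC :: 'k toeplitz_lpa)"
    and "lpa_gen GC' * lpa_gen GV = (lpa_gen GC' :: 'k toeplitz_lpa)"
    and "lpa_gen GD' * lpa_gen GV = (lpa_gen GD' :: 'k toeplitz_lpa)"
    and "lpa_gen GW * lpa_gen GD' = (lpa_gen GD' :: 'k toeplitz_lpa)"
    and "lpa_gen GD * lpa_gen GW = (lpa_gen GD :: 'k toeplitz_lpa)"
    and "lpa_gen GC' * lpa_gen GC = (lpa_gen GV :: 'k toeplitz_lpa)"
    and "lpa_gen GD' * lpa_gen GD = (lpa_gen GW :: 'k toeplitz_lpa)"
    and "lpa_gen GC' * lpa_gen GD = (0 :: 'k toeplitz_lpa)"
    and "lpa_gen GD' * lpa_gen GC = (0 :: 'k toeplitz_lpa)"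
proof -
  have "abs_toeplitz_lpa (word [GV] + word [GW]) = (abs_toeplitz_lpa 1 :: 'k toeplitz_lpa)"
    by (rule lpa_relation) (simp add: toeplitz_relations_def)
  then show "lpa_gen GV + lpa_gen GW = (1 :: 'k::field toeplitz_lpa)"
    by (simp add: lpa_gen.abs_eq plus_toeplitz_lpa.abs_eq one_toeplitz_lpa.abs_eq)
qed (unfold lpa_gen_mult, unfold lpa_gen.abs_eq zero_toeplitz_lpa.abs_eq,
    (rule lpa_relation lpa_relation[symmetric], simp add: toeplitz_relations_def)+)

text \<open>
  Further products that vanish because the two factors do not meet at a common vertex.
\<close>

lemma lpa_gen_products:
  shows "lpa_gen GC' * lpa_gen GW = (0 :: 'k::field toeplitz_lpa)"
    and "lpa_gen GD' * lpa_gen GW = (0 :: 'k toeplitz_lpa)"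
    and "lpa_gen GW * lpa_gen GC = (0 :: 'k toeplitz_lpa)"
    and "lpa_gen GD * lpa_gen GC = (0 :: 'k toeplitz_lpa)"
    and "lpa_gen GD' * lpa_gen GD' = (0 :: 'k toeplitz_lpa)"
    and "lpa_gen GC' * lpa_gen GD' = (0 :: 'k toeplitz_lpa)"
proof -
  note rels = lpa_gen_relations[where 'k = 'k]
  have DV: "lpa_gen GD * lpa_gen GV = (0 :: 'k toeplitz_lpa)"
    by (metis mult.assoc mult_zero_right rels(3,8))
  show "lpa_gen GC' * lpa_gen GW = (0 :: 'k toeplitz_lpa)"
    by (metis mult.assoc mult_zero_right rels(2,5))
  show DW: "lpa_gen GD' * lpa_gen GW = (0 :: 'k toeplitz_lpa)"
    by (metis mult.assoc mult_zero_right rels(2,6))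
  show "lpa_gen GW * lpa_gen GC = (0 :: 'k toeplitz_lpa)"
    by (metis mult.assoc mult_zero_left rels(3,4))
  show "lpa_gen GD * lpa_gen GC = (0 :: 'k toeplitz_lpa)"
    by (metis mult.assoc mult_zero_left DV rels(4))
  show "lpa_gen GD' * lpa_gen GD' = (0 :: 'k toeplitz_lpa)"
    by (metis mult.assoc mult_zero_left DW rels(7))
  show "lpa_gen GC' * lpa_gen GD' = (0 :: 'k toeplitz_lpa)"
    by (metis mult.assoc mult_zero_left mult_zero_right rels(2,5,7))
qed

section \<open>Polynomials evaluated in the Leavitt path algebra\<close>

text \<open>
  The evaluation of \<^const>\<open>poly_c\<close> at an arbitrary element; the values at \<open>c\<close> and at \<open>c\<^sup>* + d\<^sup>*\<close> are
  needed. It is a ring homomorphism since scalars are central.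
\<close>

definition poly_at :: "'k::field poly \<Rightarrow> 'k toeplitz_lpa \<Rightarrow> 'k toeplitz_lpa" where
  "poly_at g a = (\<Sum>i\<le>degree g. lpa_scalar (poly.coeff g i) * a ^ i)"

lemma poly_c_eq_poly_at: "poly_c g = poly_at g (lpa_gen GC)"
  by (simp add: poly_c_def poly_at_def)

lemma poly_at_superset:
  assumes "degree g \<le> n"
  shows "poly_at g a = (\<Sum>i\<le>n. lpa_scalar (poly.coeff g i) * a ^ i)"
  unfolding poly_at_def using assms
  by (intro sum.mono_neutral_left) (auto simp: coeff_eq_0)

lemma poly_at_0 [simp]: "poly_at 0 a = 0"
  by (simp add: poly_at_def)

lemma poly_at_pCons: "poly_at (pCons k g) a = lpa_scalar k + a * poly_at g a"
proof -
  have "poly_at (pCons k g) a =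
      (\<Sum>i\<le>Suc (degree g). lpa_scalar (poly.coeff (pCons k g) i) * a ^ i)"
    by (rule poly_at_superset) (simp add: degree_pCons_le)
  also have "\<dots> = lpa_scalar k + (\<Sum>i\<le>degree g. lpa_scalar (poly.coeff g i) * (a * a ^ i))"
    by (simp add: sum.atMost_Suc_shift del: sum.atMost_Suc)
  also have "\<dots> = lpa_scalar k + a * poly_at g a"
    by (simp add: poly_at_def sum_distrib_left lpa_scalar_commute mult.assoc)
  finally show ?thesis .
qed

lemma poly_at_add: "poly_at (p + q) a = poly_at p a + poly_at q a"
proof -
  let ?n = "max (degree p) (degree q)"
  show ?thesis
    using poly_at_superset[of "p + q" ?n a] poly_at_superset[of p ?n a] poly_at_superset[of q ?n a]
    by (simp add: degree_add_le_max lpa_scalar_add distrib_right sum.distrib)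
qed

lemma poly_at_smult: "poly_at (Polynomial.smult k p) a = lpa_scalar k * poly_at p a"
  by (induction p)
     (simp_all add: poly_at_pCons lpa_scalar_mult distrib_left, metis lpa_scalar_commute mult.assoc)

lemma poly_at_mult: "poly_at (p * q) a = poly_at p a * poly_at q a"
  by (induction p) (simp_all add: poly_at_pCons poly_at_add poly_at_smult distrib_right mult.assoc)

lemma poly_at_1 [simp]: "poly_at 1 a = 1"
  by (simp add: one_pCons poly_at_pCons)

lemma poly_at_X [simp]: "poly_at [:0, 1:] a = a"
  by (simp add: poly_at_pCons)

lemma poly_at_X_power: "poly_at ([:0, 1:] ^ n) a = a ^ n"
  by (induction n) (simp_all add: poly_at_mult del: mult_pCons_left)

lemma poly_at_uminus: "poly_at (- p) a = - poly_at p a"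
  using poly_at_add[of p "- p" a] by (simp add: minus_unique)

lemma poly_at_diff: "poly_at (p - q) a = poly_at p a - poly_at q a"
  using poly_at_add[of p "- q" a] by (simp add: poly_at_uminus)

section \<open>Reduction to polynomials in \<open>c\<^sup>* + d\<^sup>*\<close>\<close>

text \<open>
  With \<open>x = c + d\<close>, this element \<open>y\<close> satisfies \<open>y x = v + w = 1\<close> and \<open>x y = v\<close>: it is a one-sided
  inverse of a shift, as in the presentation of the algebra by \<open>x\<close> and \<open>y\<close> with the single
  relation \<open>y x = 1\<close>.
\<close>

definition lpa_shift :: "'k::field toeplitz_lpa" where
  "lpa_shift = lpa_gen GC' + lpa_gen GD'"

lemma lpa_shift_mult_gen:
  shows "lpa_shift * lpa_gen GV = (lpa_shift :: 'k::field toeplitz_lpa)"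
    and "lpa_shift * lpa_gen GW = (0 :: 'k toeplitz_lpa)"
    and "lpa_shift * lpa_gen GC = (lpa_gen GV :: 'k toeplitz_lpa)"
    and "lpa_shift * lpa_gen GD = (lpa_gen GW :: 'k toeplitz_lpa)"
    and "lpa_shift * lpa_gen GD' = (0 :: 'k toeplitz_lpa)"
    and "lpa_shift * lpa_gen GC' = (lpa_shift ^ 2 :: 'k toeplitz_lpa)"
  by (simp_all add: lpa_shift_def distrib_right distrib_left power2_eq_square
      lpa_gen_relations lpa_gen_products)

text \<open>
  A high enough power of the shift cancels every \<open>c\<close> and \<open>d\<close> in \<open>r\<close>. The statement passes to
  products because polynomials in the shift commute with its powers.
\<close>

lemma ex_shift_power_mult_eq_poly_at:
  fixes r :: "'k::field toeplitz_lpa"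
  shows "\<exists>n p. lpa_shift ^ n * r = poly_at p lpa_shift"
proof (induction r rule: lpa_induct)
  case (scalar k)
  have "lpa_shift ^ 0 * lpa_scalar k = poly_at [:k:] lpa_shift" by (simp add: poly_at_pCons)
  then show ?case by blast
next
  case (gen g)
  have *: ?case if "lpa_shift ^ n * lpa_gen g = (lpa_shift ^ m :: 'k toeplitz_lpa)" for n m
  proof -
    have "lpa_shift ^ n * lpa_gen g = poly_at ([:0, 1:] ^ m) (lpa_shift :: 'k toeplitz_lpa)"
      using that by (simp only: poly_at_X_power)
    then show ?thesis by blast
  qed
  note shift = lpa_shift_mult_gen[where 'k = 'k]
  have 2: "lpa_shift ^ 2 * x = lpa_shift * (lpa_shift * x)" for x :: "'k toeplitz_lpa"
    by (simp add: power2_eq_square mult.assoc)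
  show ?case
  proof (cases g)
    case GV
    then show ?thesis using *[of 1 1] shift by simp
  next
    case GW
    then have "lpa_shift ^ 1 * lpa_gen g = poly_at 0 (lpa_shift :: 'k toeplitz_lpa)"
        using shift by simp
    then show ?thesis by blast
  next
    case GC
    then show ?thesis using *[of 2 1] shift by (simp add: 2)
  next
    case GD
    then have "lpa_shift ^ 2 * lpa_gen g = poly_at 0 (lpa_shift :: 'k toeplitz_lpa)"
        using shift by (simp add: 2)
    then show ?thesis by blast
  next
    case GC'
    then show ?thesis using *[of 1 2] shift by simp
  next
    case GD'
    then have "lpa_shift ^ 1 * lpa_gen g = poly_at 0 (lpa_shift :: 'k toeplitz_lpa)"
        using shift by simp
    then show ?thesis by blast
  qed
next
  case (add r s)
  then obtain n p m q where "lpa_shift ^ n * r = poly_at p lpa_shift"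
      "lpa_shift ^ m * s = poly_at q lpa_shift"
    by blast
  then have "lpa_shift ^ (m + n) * (r + s) = poly_at ([:0, 1:] ^ m * p + [:0, 1:] ^ n * q) lpa_shift"
    by (simp add: poly_at_add poly_at_mult poly_at_X_power distrib_left power_add mult.assoc)
       (metis mult.assoc power_add power_commutes add.commute)
  then show ?case by blast
next
  case (mult r s)
  then obtain n p m q where *: "lpa_shift ^ n * r = poly_at p lpa_shift"
      "lpa_shift ^ m * s = poly_at q lpa_shift"
    by blast
  have "lpa_shift ^ (m + n) * (r * s) = lpa_shift ^ m * (poly_at p lpa_shift * s)"
    by (simp add: power_add mult.assoc flip: *(1))
  also have "\<dots> = (lpa_shift ^ m * poly_at p lpa_shift) * s"
    by (simp add: mult.assoc)
  also have "\<dots> = (poly_at p lpa_shift * lpa_shift ^ m) * s"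
    by (metis poly_at_X_power poly_at_mult mult.commute)
  also have "\<dots> = poly_at (p * q) lpa_shift"
    by (simp add: poly_at_mult mult.assoc *(2))
  finally show ?case by blast
qed

section \<open>The quotient by the left ideal of a polynomial in \<open>c\<close>\<close>

fun gen_poly :: "'k::field poly \<Rightarrow> gen \<Rightarrow> 'k poly" where
  "gen_poly g GV = 1"
| "gen_poly g GW = 0"
| "gen_poly g GC = [:0, 1:]"
| "gen_poly g GC' = g"
| "gen_poly g GD = 0"
| "gen_poly g GD' = 0"

definition word_poly :: "'k::field poly \<Rightarrow> gen list \<Rightarrow> 'k poly" where
  "word_poly g u = prod_list (map (gen_poly g) u)"

definition free_poly :: "'k::field poly \<Rightarrow> 'k free_alg \<Rightarrow> 'k poly" where
  "free_poly g p =
    (\<Sum>u\<in>Poly_Mapping.keys p. Polynomial.smult (Poly_Mapping.lookup p u) (word_poly g u))"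

lemma free_poly_superset:
  assumes "finite S" "Poly_Mapping.keys p \<subseteq> S"
  shows "free_poly g p = (\<Sum>u\<in>S. Polynomial.smult (Poly_Mapping.lookup p u) (word_poly g u))"
  unfolding free_poly_def using assms
  by (intro sum.mono_neutral_left) (auto simp: in_keys_iff)

lemma free_poly_add: "free_poly g (p + q) = free_poly g p + free_poly g q"
  using free_poly_superset[of "Poly_Mapping.keys p \<union> Poly_Mapping.keys q" _ g]
      Poly_Mapping.keys_add[of p q]
  by (simp add: lookup_add sum.distrib smult_add_left)

lemma free_poly_single [simp]:
  "free_poly g (Poly_Mapping.single u k) = Polynomial.smult k (word_poly g u)"
  by (simp add: free_poly_def)

lemma free_poly_0 [simp]: "free_poly g 0 = 0"
  by (simp add: free_poly_def)

lemma free_poly_1 [simp]: "free_poly g 1 = 1"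
  using free_poly_single[of g "[]" 1] by (simp add: word_poly_def zero_list_def flip: single_one)

lemma free_poly_mult: "free_poly g (p * q) = free_poly g p * free_poly g q"
proof (induction p rule: free_alg_induct)
  case (single u k)
  show ?case
    by (induction q rule: free_alg_induct)
       (simp_all add: single_mult_single word_poly_def distrib_left free_poly_add
           mult.commute smult_add_right)
qed (simp_all add: distrib_right free_poly_add)

text \<open>
  The polynomial \<open>g\<close> represents the inverse of \<open>x\<close> modulo \<open>F\<close>, so that \<open>c\<^sup>*\<close> can act on \<open>K[x]/F\<close> as
  multiplication by \<open>g\<close>. Values are taken in \<open>K[x]\<close> and compared modulo \<open>F\<close>.
\<close>

locale inverse_mod =
  fixes F g :: "'k::field poly"
  assumes inverse_mod: "[[:0, 1:] * g = 1] (mod F)"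
begin

text \<open>
  \<open>c\<^sup>*c = v\<close> and \<open>cc\<^sup>* + dd\<^sup>* = v\<close> hold modulo \<open>F\<close> because \<open>g\<close> is inverse to \<open>x\<close>; the other relations
  hold in \<open>K[x]\<close> itself.
\<close>

lemma free_poly_cong: "toeplitz_cong a b \<Longrightarrow> [free_poly g a = free_poly g b] (mod F)"
proof (induction rule: toeplitz_cong.induct)
  case (rel a b)
  then show ?case
    using inverse_mod
    by (auto simp: toeplitz_relations_def free_poly_add word_poly_def mult.commute one_pCons)
qed (auto simp: free_poly_add free_poly_mult intro: cong_add cong_mult cong_sym cong_trans)

definition lpa_poly :: "'k toeplitz_lpa \<Rightarrow> 'k poly" where
  "lpa_poly r = free_poly g (rep_toeplitz_lpa r)"

lemma lpa_poly_abs: "[lpa_poly (abs_toeplitz_lpa p) = free_poly g p] (mod F)"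
  unfolding lpa_poly_def
  by (rule free_poly_cong) (metis Quotient_toeplitz_lpa Quotient_rep_abs toeplitz_cong.refl)

lemma lpa_abs_rep: "abs_toeplitz_lpa (rep_toeplitz_lpa r) = r"
  by (metis Quotient_toeplitz_lpa Quotient_abs_rep)

lemma lpa_poly_add: "[lpa_poly (r + s) = lpa_poly r + lpa_poly s] (mod F)"
  using lpa_poly_abs[of "rep_toeplitz_lpa r + rep_toeplitz_lpa s"]
  by (simp add: free_poly_add lpa_abs_rep flip: plus_toeplitz_lpa.abs_eq lpa_poly_def)

lemma lpa_poly_mult: "[lpa_poly (r * s) = lpa_poly r * lpa_poly s] (mod F)"
  using lpa_poly_abs[of "rep_toeplitz_lpa r * rep_toeplitz_lpa s"]
  by (simp add: free_poly_mult lpa_abs_rep flip: times_toeplitz_lpa.abs_eq lpa_poly_def)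

lemma lpa_poly_scalar: "[lpa_poly (lpa_scalar k) = [:k:]] (mod F)"
  using lpa_poly_abs[of "free_scalar k"] by (simp add: lpa_scalar.abs_eq word_poly_def)

lemma lpa_poly_gen: "[lpa_poly (lpa_gen h) = gen_poly g h] (mod F)"
  using lpa_poly_abs[of "word [h]"] by (simp add: lpa_gen.abs_eq word_poly_def)

lemma lpa_poly_1: "[lpa_poly 1 = 1] (mod F)"
  using lpa_poly_scalar[of 1] by (simp flip: one_pCons)

lemma lpa_poly_0: "[lpa_poly 0 = 0] (mod F)"
  using lpa_poly_scalar[of 0] by simp

lemma lpa_poly_uminus: "[lpa_poly (- r) = - lpa_poly r] (mod F)"
proof -
  have "[0 = lpa_poly r + lpa_poly (- r)] (mod F)"
    using lpa_poly_add[of r "- r"] cong_trans cong_sym lpa_poly_0 by (metis add.right_inverse)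
  then have "[0 - lpa_poly r = lpa_poly r + lpa_poly (- r) - lpa_poly r] (mod F)"
    by (intro cong_diff cong_refl)
  then show ?thesis by (simp add: cong_sym)
qed

lemma lpa_poly_diff: "[lpa_poly (r - s) = lpa_poly r - lpa_poly s] (mod F)"
  using cong_trans[OF lpa_poly_add[of r "- s"] cong_add[OF cong_refl lpa_poly_uminus]] by simp

lemma lpa_poly_poly_at:
  assumes "[lpa_poly a = b] (mod F)"
  shows "[lpa_poly (poly_at p a) = pcompose p b] (mod F)"
proof (induction p)
  case 0
  then show ?case by (simp add: lpa_poly_0)
next
  case (pCons k p)
  have "[lpa_poly (lpa_scalar k + a * poly_at p a)
      = lpa_poly (lpa_scalar k) + lpa_poly (a * poly_at p a)] (mod F)"
    by (rule lpa_poly_add)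
  also have "[lpa_poly (lpa_scalar k) + lpa_poly (a * poly_at p a)
      = [:k:] + lpa_poly a * lpa_poly (poly_at p a)] (mod F)"
    by (intro cong_add lpa_poly_mult lpa_poly_scalar)
  also have "[[:k:] + lpa_poly a * lpa_poly (poly_at p a) = [:k:] + b * pcompose p b] (mod F)"
    by (intro cong_add cong_mult assms pCons.IH cong_refl)
  finally show ?case by (simp add: poly_at_pCons pcompose_pCons)
qed

lemma lpa_poly_poly_c: "[lpa_poly (poly_c p) = p] (mod F)"
  using lpa_poly_poly_at[OF lpa_poly_gen[of GC], of p]
  by (simp add: poly_c_eq_poly_at pcompose_idR)

lemma lpa_poly_shift: "[lpa_poly lpa_shift = g] (mod F)"
  using cong_trans[OF lpa_poly_add[of "lpa_gen GC'" "lpa_gen GD'"]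
      cong_add[OF lpa_poly_gen lpa_poly_gen]]
  by (simp add: lpa_shift_def)

definition RF :: "'k toeplitz_lpa set" where "RF = range (\<lambda>r. r * poly_c F)"

lemma RF_add: "a \<in> RF \<Longrightarrow> b \<in> RF \<Longrightarrow> a + b \<in> RF"
  by (auto simp: RF_def simp flip: distrib_right)

lemma RF_mult: "a \<in> RF \<Longrightarrow> r * a \<in> RF"
  by (auto simp: RF_def simp flip: mult.assoc)

lemma RF_uminus: "a \<in> RF \<Longrightarrow> - a \<in> RF"
  using RF_mult[of a "- 1"] by simp

text \<open>
  Polynomials in \<open>c\<close> commute with \<open>F(c)\<close>, and so act on the quotient from the right as well. This
  is what makes the reduction below compatible with products.
\<close>

lemma RF_mult_poly_c: "a \<in> RF \<Longrightarrow> a * poly_c p \<in> RF"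
proof -
  have "poly_c F * poly_c p = poly_c p * poly_c F"
    by (simp add: poly_c_eq_poly_at mult.commute flip: poly_at_mult)
  then show "a \<in> RF \<Longrightarrow> a * poly_c p \<in> RF"
    unfolding RF_def by (auto simp: mult.assoc) (metis mult.assoc rangeI)
qed

lemma poly_c_mem_RF: "F dvd p \<Longrightarrow> poly_c p \<in> RF"
  by (auto simp: RF_def poly_c_eq_poly_at poly_at_mult mult.commute[of F] elim!: dvdE)

text \<open>
  Every element is a polynomial in \<open>c\<close> modulo \<open>R F(c)\<close>. That ideal contains \<open>c g(c) - 1\<close>, since
  \<open>F\<close> divides \<open>x g - 1\<close>. Multiplying this from the left by a generator that annihilates \<open>c\<close>, which
  is the case for \<open>w\<close>, \<open>d\<close> and \<open>d\<^sup>*\<close>, puts that generator into the ideal, and multiplying it by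
  \<open>c\<^sup>*\<close> gives \<open>c\<^sup>* \<equiv> v g(c) \<equiv> g(c)\<close>.
\<close>

lemma ex_poly_c_cong: "\<exists>p. r - poly_c p \<in> RF"
proof (induction r rule: lpa_induct)
  case (scalar k)
  have "lpa_scalar k - poly_c [:k:] = 0 * poly_c F" by (simp add: poly_c_eq_poly_at poly_at_pCons)
  then show ?case unfolding RF_def by (metis rangeI)
next
  case (gen h)
  note rels = lpa_gen_relations[where 'k = 'k] lpa_gen_products[where 'k = 'k]
  have one: "lpa_gen GC * poly_c g - 1 \<in> RF"
    using poly_c_mem_RF[of "[:0, 1:] * g - 1"] inverse_mod
    by (simp add: poly_c_eq_poly_at poly_at_mult poly_at_diff cong_iff_dvd_diff del: mult_pCons_left)
  have kill: "lpa_gen b \<in> RF" if "lpa_gen b * lpa_gen GC = (0 :: 'k toeplitz_lpa)" for b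
    using RF_uminus[OF RF_mult[OF one, of "lpa_gen b"]] that
    by (simp add: right_diff_distrib flip: mult.assoc)
  have zero: ?case if "lpa_gen h \<in> RF"
    using that by (intro exI[of _ 0]) (simp add: poly_c_eq_poly_at)
  have W: "lpa_gen GW \<in> RF" by (rule kill) (simp add: rels)
  have V: "lpa_gen GV = 1 - (lpa_gen GW :: 'k toeplitz_lpa)"
    using rels(1) by (simp add: algebra_simps)
  show ?case
  proof (cases h)
    case GV
    have "lpa_gen GV - poly_c 1 \<in> RF" using RF_uminus[OF W] V by (simp add: poly_c_eq_poly_at)
    then show ?thesis using GV by blast
  next
    case GC
    have "lpa_gen GC - poly_c [:0, 1:] \<in> RF"
        using RF_mult[OF W, of 0] by (simp add: poly_c_eq_poly_at)
    then show ?thesis using GC by blast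
  next
    case GC'
    have "lpa_gen GC' - lpa_gen GV * poly_c g \<in> RF"
      using RF_uminus[OF RF_mult[OF one, of "lpa_gen GC'"]]
      by (simp add: right_diff_distrib rels flip: mult.assoc)
    from RF_add[OF this RF_uminus[OF RF_mult_poly_c[OF W, of g]]]
    have "lpa_gen GC' - poly_c g \<in> RF" by (simp add: V algebra_simps)
    then show ?thesis using GC' by blast
  qed (use zero W kill rels in auto)
next
  case (add r s)
  then obtain p q where "r - poly_c p \<in> RF" "s - poly_c q \<in> RF" by blast
  from RF_add[OF this] have "r + s - poly_c (p + q) \<in> RF"
    by (simp add: poly_c_eq_poly_at poly_at_add algebra_simps)
  then show ?case by blast
next
  case (mult r s)
  then obtain p q where "r - poly_c p \<in> RF" "s - poly_c q \<in> RF" by blast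
  from RF_add[OF RF_mult[OF this(2), of r] RF_mult_poly_c[OF this(1), of q]]
  have "r * s - poly_c (p * q) \<in> RF"
    by (simp add: poly_c_eq_poly_at poly_at_mult algebra_simps)
  then show ?case by blast
qed

lemma lpa_poly_RF: "a \<in> RF \<Longrightarrow> F dvd lpa_poly a"
proof -
  have "[lpa_poly (r * poly_c F) = 0] (mod F)" for r
    using cong_trans[OF lpa_poly_mult[of r "poly_c F"] cong_mult[OF cong_refl lpa_poly_poly_c]]
    by (rule cong_trans) (simp add: cong_0_iff)
  then show "a \<in> RF \<Longrightarrow> F dvd lpa_poly a" by (auto simp: RF_def cong_0_iff)
qed

lemma diff_poly_c_lpa_poly_mem_RF: "r - poly_c (lpa_poly r) \<in> RF"
proof -
  obtain p where p: "r - poly_c p \<in> RF" using ex_poly_c_cong by blast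
  have "[lpa_poly r - p = lpa_poly (r - poly_c p)] (mod F)"
    using cong_trans[OF lpa_poly_diff[of r "poly_c p"] cong_diff[OF cong_refl lpa_poly_poly_c]]
    by (rule cong_sym)
  then have "F dvd lpa_poly r - p"
    using lpa_poly_RF[OF p] by (metis cong_0_iff cong_trans)
  then have "F dvd p - lpa_poly r" by (metis dvd_minus_iff minus_diff_eq)
  from RF_add[OF p poly_c_mem_RF[OF this]] show ?thesis
    by (simp add: poly_c_eq_poly_at poly_at_diff)
qed

text \<open>
  The homomorphism to \<open>K[x]/F\<close> has kernel \<open>R F(c)\<close>: every element is congruent to a polynomial in
  \<open>c\<close>, and the homomorphism sends \<open>p(c)\<close> to the class of \<open>p\<close>.
\<close>

theorem mem_RF_iff: "r \<in> RF \<longleftrightarrow> F dvd lpa_poly r"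
  using lpa_poly_RF RF_add[OF diff_poly_c_lpa_poly_mem_RF poly_c_mem_RF, of "lpa_poly r" r] by auto

end

section \<open>Arithmetic of polynomials over a field\<close>

text \<open>
  A nonzero element of least degree, if there is one, generates the ideal, by division with
  remainder.
\<close>

lemma poly_ideal_principal:
  fixes A :: "'k::field poly set"
  assumes zero: "0 \<in> A" and add: "\<And>p q. p \<in> A \<Longrightarrow> q \<in> A \<Longrightarrow> p + q \<in> A"
    and mult: "\<And>p q. q \<in> A \<Longrightarrow> p * q \<in> A"
  obtains q where "q \<in> A" "\<And>p. p \<in> A \<Longrightarrow> q dvd p"
proof (cases "A = {0}")
  case True
  then show ?thesis using that[of 0] by auto
next
  case False
  then obtain p0 where "p0 \<in> A \<and> p0 \<noteq> 0" using zero by blast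
  then obtain q where q: "q \<in> A \<and> q \<noteq> 0"
    and least: "\<And>p. p \<in> A \<and> p \<noteq> 0 \<Longrightarrow> degree q \<le> degree p"
    using ex_has_least_nat[of "\<lambda>p. p \<in> A \<and> p \<noteq> 0" p0 degree] by blast
  have "q dvd p" if p: "p \<in> A" for p
  proof (rule ccontr)
    assume "\<not> q dvd p"
    then have "p mod q \<noteq> 0" by (simp add: mod_eq_0_iff_dvd)
    moreover have "p mod q = p + (- (p div q)) * q"
      by (simp add: minus_div_mult_eq_mod[symmetric])
    then have "p mod q \<in> A" using add[OF p mult] q by metis
    ultimately show False
      using least[of "p mod q"] degree_mod_less[of q p] q by simp
  qed
  then show ?thesis using that q by blast
qed

text \<open>
  Modulo \<open>f\<close> an inverse comes from a generator of the ideal of \<open>f\<close> and \<open>q\<close>, which is a unit. If \<open>q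
  s - 1\<close> and \<open>q t - 1\<close> are divisible by \<open>f\<close> and by \<open>f ^ n\<close>, then their product has the form \<open>1 - q
  z\<close> and is divisible by \<open>f ^ Suc n\<close>.
\<close>

lemma ex_inverse_mod_irreducible_power:
  fixes f q :: "'k::field poly"
  assumes f: "irreducible f" and q: "\<not> f dvd q"
  shows "\<exists>s. [q * s = 1] (mod f ^ n)"
proof (induction n)
  case (Suc n)
  have "\<exists>s. f dvd q * s - 1"
  proof -
    obtain d where d: "d \<in> {a * f + b * q | a b. True}"
      and dvd: "\<And>p. p \<in> {a * f + b * q | a b. True} \<Longrightarrow> d dvd p"
    proof (rule poly_ideal_principal)
      show "0 \<in> {a * f + b * q | a b. True}" by (auto intro: exI[of _ 0])
    next
      fix p p' assume "p \<in> {a * f + b * q | a b. True}" "p' \<in> {a * f + b * q | a b. True}"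
      then obtain a b a' b' where "p = a * f + b * q" "p' = a' * f + b' * q" by blast
      then have "p + p' = (a + a') * f + (b + b') * q" by (simp add: algebra_simps)
      then show "p + p' \<in> {a * f + b * q | a b. True}" by blast
    next
      fix r p assume "p \<in> {a * f + b * q | a b. True}"
      then obtain a b where "p = a * f + b * q" by blast
      then have "r * p = (r * a) * f + (r * b) * q" by (simp add: algebra_simps)
      then show "r * p \<in> {a * f + b * q | a b. True}" by blast
    qed blast
    have "1 * f + 0 * q \<in> {a * f + b * q | a b. True}" "0 * f + 1 * q \<in> {a * f + b * q | a b. True}"
      by blast+
    from this[THEN dvd] have "d dvd f" "d dvd q" by simp_all
    have "\<not> f dvd d" using \<open>d dvd q\<close> q dvd_trans by blast
    with \<open>d dvd f\<close> have "d dvd 1"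
      using irreducibleD'[OF f] by blast
    then obtain e where e: "1 = d * e" by (elim dvdE)
    obtain a b where "d = a * f + b * q" using d by blast
    with e have "q * (b * e) - 1 = f * (- a * e)" by (simp add: algebra_simps)
    then show ?thesis by (metis dvd_triv_left)
  qed
  then obtain s where s: "f dvd q * s - 1" by blast
  obtain t where t: "f ^ n dvd q * t - 1" using Suc by (auto simp: cong_iff_dvd_diff)
  have "f ^ Suc n dvd (q * s - 1) * (q * t - 1)" using mult_dvd_mono[OF s t] by simp
  also have "(q * s - 1) * (q * t - 1) = - (q * (s + t - q * s * t) - 1)"
    by (simp add: algebra_simps)
  finally show ?case unfolding cong_iff_dvd_diff by (metis dvd_minus_iff)
qed simp

lemma ex_irreducible_power_factor:
  fixes f p :: "'k::field poly"
  assumes f: "irreducible f" and "p \<noteq> 0"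
  obtains k p' where "p = f ^ k * p'" "\<not> f dvd p'"
proof -
  have "\<exists>k p'. p = f ^ k * p' \<and> \<not> f dvd p'"
    using \<open>p \<noteq> 0\<close>
  proof (induction "degree p" arbitrary: p rule: less_induct)
    case less
    show ?case
    proof (cases "f dvd p")
      case True
      then obtain h where h: "p = f * h" by (elim dvdE)
      have "degree f \<noteq> 0"
        using f by (metis irreducible_not_unit irreducible_def is_unit_iff_degree)
      then have "degree h < degree p" "h \<noteq> 0" using h less.prems by (auto simp: degree_mult_eq)
      with less obtain k p' where "h = f ^ k * p'" "\<not> f dvd p'" by blast
      then have "p = f ^ Suc k * p'" using h by simp
      then show ?thesis using \<open>\<not> f dvd p'\<close> by blast
    next
      case False
      then show ?thesis by (intro exI[of _ 0] exI[of _ p]) simp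
    qed
  qed
  then show ?thesis using that by blast
qed

text \<open>
  Clearing denominators in \<open>q (1/x)\<close>: multiplication by \<open>x\<close> to the degree of \<open>q\<close> reverses the
  coefficients.
\<close>

lemma X_power_mult_pcompose_cong:
  fixes q :: "'k::field poly"
  assumes "[[:0, 1:] * g = 1] (mod F)"
  shows "[[:0, 1:] ^ degree q * pcompose q g = reflect_poly q] (mod F)"
proof (induction q)
  case (pCons c q)
  show ?case
  proof (cases "q = 0")
    case False
    have "[:0, 1:] ^ degree (pCons c q) * pcompose (pCons c q) g =
        Polynomial.monom c (Suc (degree q)) + [:0, 1:] ^ degree q * pcompose q g * ([:0, 1:] * g)"
      using False by (simp add: pcompose_pCons monom_altdef algebra_simps)
    also have "[\<dots> = Polynomial.monom c (Suc (degree q)) + reflect_poly q * 1] (mod F)"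
      by (intro cong_add cong_mult cong_refl pCons.IH assms)
    finally show ?thesis using False by (simp add: reflect_poly_pCons' add.commute)
  qed simp
qed simp

section \<open>Quotients of the ring of a type\<close>

lemma ring_of_type_algebra_simps [simp]:
  "carrier ring_of_type_algebra = UNIV"
  "x \<otimes>\<^bsub>ring_of_type_algebra\<^esub> y = x * y"
  "\<one>\<^bsub>ring_of_type_algebra\<^esub> = 1"
  "\<zero>\<^bsub>ring_of_type_algebra\<^esub> = 0"
  "x \<oplus>\<^bsub>ring_of_type_algebra\<^esub> y = x + y"
  by (simp_all add: ring_of_type_algebra_def)

lemma a_r_coset_eq_iff:
  fixes J :: "'r::ring_1 set"
  assumes "0 \<in> J" "\<And>x y. x \<in> J \<Longrightarrow> y \<in> J \<Longrightarrow> x + y \<in> J" "\<And>x. x \<in> J \<Longrightarrow> - x \<in> J"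
  shows "J +>\<^bsub>ring_of_type_algebra\<^esub> r = J +>\<^bsub>ring_of_type_algebra\<^esub> s \<longleftrightarrow> r - s \<in> J"
proof
  assume eq: "J +>\<^bsub>ring_of_type_algebra\<^esub> r = J +>\<^bsub>ring_of_type_algebra\<^esub> s"
  have "r \<in> J +>\<^bsub>ring_of_type_algebra\<^esub> r" using assms(1) by (force simp: a_r_coset_def')
  then show "r - s \<in> J" unfolding eq by (auto simp: a_r_coset_def')
next
  assume rs: "r - s \<in> J"
  have "x + r = (x + (r - s)) + s" "x + s = (x + - (r - s)) + r" for x by simp_all
  then have "(\<lambda>x. x + r) ` J = (\<lambda>x. x + s) ` J"
    using assms(2)[OF _ rs] assms(2)[OF _ assms(3)[OF rs]]
        by (metis (no_types, lifting) image_eqI subsetI subset_antisym image_iff)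
  then show "J +>\<^bsub>ring_of_type_algebra\<^esub> r = J +>\<^bsub>ring_of_type_algebra\<^esub> s"
    by (auto simp: a_r_coset_def' image_def)
qed

section \<open>The field \<open>K[x]/\<langle>f\<rangle>\<close>\<close>

context
  fixes f :: "'k::field poly"
begin

interpretation P: cring "ring_of_type_algebra :: 'k poly ring"
  by (rule cring_from_type_algebra)

lemma PIdl_eq: "PIdl\<^bsub>ring_of_type_algebra\<^esub> f = {p. f dvd p}"
  by (auto simp: cgenideal_def dvd_def mult.commute)

interpretation I: ideal "PIdl\<^bsub>ring_of_type_algebra\<^esub> f" "ring_of_type_algebra :: 'k poly ring"
  by (rule P.cgenideal_ideal) simp

lemma residue_hom: "residue f \<in> ring_hom ring_of_type_algebra (residue_field f)"
  unfolding residue_field_def using I.rcos_ring_hom by (simp add: residue_def[abs_def])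

lemma residue_closed: "residue f p \<in> carrier (residue_field f)"
  using ring_hom_closed[OF residue_hom] by simp

lemma residue_add: "residue f p \<oplus>\<^bsub>residue_field f\<^esub> residue f q = residue f (p + q)"
  using ring_hom_add[OF residue_hom, of p q] by simp

lemma residue_mult: "residue f p \<otimes>\<^bsub>residue_field f\<^esub> residue f q = residue f (p * q)"
  using ring_hom_mult[OF residue_hom, of p q] by simp

lemma residue_one: "\<one>\<^bsub>residue_field f\<^esub> = residue f 1"
  using ring_hom_one[OF residue_hom] by simp

lemma cring_residue_field: "cring (residue_field f)"
  unfolding residue_field_def by (rule I.quotient_is_cring) (rule cring_from_type_algebra)

lemma residue_zero: "\<zero>\<^bsub>residue_field f\<^esub> = residue f 0"
  using ring_hom_zero[OF residue_hom P.ring_axioms] cring_residue_field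
  by (simp add: cring_def)

lemma residue_eq_iff: "residue f p = residue f q \<longleftrightarrow> f dvd p - q"
  unfolding residue_def by (subst a_r_coset_eq_iff) (auto simp: PIdl_eq)

lemma residue_carrier: "carrier (residue_field f) = range (residue f)"
  by (auto simp: residue_field_def residue_def FactRing_def A_RCOSETS_def')

lemma residue_sum:
  "finite S \<Longrightarrow> (\<Oplus>\<^bsub>residue_field f\<^esub>x\<in>S. residue f (h x)) = residue f (sum h S)"
proof (induction S rule: finite_induct)
  case empty
  interpret cring "residue_field f" by (rule cring_residue_field)
  show ?case by (simp add: residue_zero)
next
  case (insert x S)
  interpret cring "residue_field f" by (rule cring_residue_field)
  from insert show ?case by (simp add: residue_closed residue_add)
qed

end

section \<open>The modules \<open>M\<^sub>n\<^sup>f\<close> and their limit\<close>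

locale prufer =
  fixes f :: "'k::field poly"
  assumes irreducible_f: "irreducible f" and f_at_0: "poly f 0 = - 1"
begin

lemma f_not_unit: "\<not> f dvd 1"
  using irreducible_f by (rule irreducible_not_unit)

lemma f_nonzero: "f \<noteq> 0"
  using irreducible_f by auto

text \<open>
  If \<open>x = f h\<close>, then \<open>h\<close> vanishes at \<open>0\<close>, where \<open>f\<close> does not, so \<open>x\<close> can be cancelled and \<open>f\<close> is a
  unit.
\<close>

lemma f_not_dvd_X: "\<not> f dvd [:0, 1:]"
proof
  assume "f dvd [:0, 1:]"
  then obtain h where h: "[:0, 1:] = f * h" by (elim dvdE)
  from arg_cong[OF this, of "\<lambda>p. poly p 0"] have "poly h 0 = 0" using f_at_0 by simp
  then obtain h' where "h = [:0, 1:] * h'" by (auto simp: poly_eq_0_iff_dvd elim: dvdE)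
  with h have "[:0, 1:] * 1 = [:0, 1:] * (f * h')" by (metis mult.left_commute mult.right_neutral)
  then have "1 = f * h'" by (subst (asm) mult_cancel_left) simp
  then show False using f_not_unit by (metis dvd_triv_left)
qed

text \<open>
  A representative of the inverse of \<open>x\<close> modulo \<open>f ^ n\<close>, which exists since \<open>f\<close> has constant
  coefficient \<open>-1\<close> and so does not divide \<open>x\<close>.
\<close>

definition inv_X :: "nat \<Rightarrow> 'k poly" where
  "inv_X n = (SOME g. [[:0, 1:] * g = 1] (mod f ^ n))"

sublocale M: inverse_mod "f ^ n" "inv_X n" for n
  using ex_inverse_mod_irreducible_power[OF irreducible_f f_not_dvd_X, of n]
  unfolding inv_X_def by unfold_locales (rule someI_ex)

lemma principal_left_ideal_eq: "principal_left_ideal toeplitz_ring (poly_c (f ^ n)) = M.RF n"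
  by (auto simp: principal_left_ideal_def M.RF_def)

lemma zero_mem_RF: "0 \<in> M.RF n"
  using M.poly_c_mem_RF[of n 0] by (simp add: poly_c_eq_poly_at)

lemma left_ideal_RF: "left_ideal (M.RF n) toeplitz_ring"
  by (auto simp: left_ideal_def zero_mem_RF M.RF_add M.RF_mult)

abbreviation coset :: "nat \<Rightarrow> 'k toeplitz_lpa \<Rightarrow> 'k toeplitz_lpa set" where
  "coset n r \<equiv> M.RF n +>\<^bsub>toeplitz_ring\<^esub> r"

lemma coset_eq_iff: "coset n r = coset n s \<longleftrightarrow> r - s \<in> M.RF n"
  by (rule a_r_coset_eq_iff) (auto intro: zero_mem_RF M.RF_add M.RF_uminus)

lemma M_mod_eq: "M_mod f n = ring_mod_left_ideal toeplitz_ring (M.RF n)"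
  by (simp add: M_mod_def principal_left_ideal_eq)

lemma left_module_M: "left_module toeplitz_ring (M_mod f n)"
  unfolding M_mod_eq by (rule left_module_ring_mod_left_ideal[OF ring_toeplitz_ring left_ideal_RF])

lemma M_carrier: "carrier (M_mod f n) = range (coset n)"
  by (auto simp: M_mod_eq ring_mod_left_ideal_carrier[OF ring_toeplitz_ring left_ideal_RF])

lemma M_add: "coset n r \<oplus>\<^bsub>M_mod f n\<^esub> coset n s = coset n (r + s)"
  by (simp add: M_mod_eq ring_mod_left_ideal_add[OF ring_toeplitz_ring left_ideal_RF])

lemma M_smult: "r \<odot>\<^bsub>M_mod f n\<^esub> coset n s = coset n (r * s)"
  by (simp add: M_mod_eq ring_mod_left_ideal_smult[OF ring_toeplitz_ring left_ideal_RF])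

lemma M_zero: "\<zero>\<^bsub>M_mod f n\<^esub> = coset n 0"
  by (simp add: M_mod_eq ring_mod_left_ideal_zero[OF ring_toeplitz_ring left_ideal_RF])

text \<open>
  Right multiplication by \<open>f\<^bsup>l - i\<^esup>(c)\<close> carries \<open>R f\<^sup>i(c)\<close> into \<open>R f\<^sup>l(c)\<close>, so the image does not
  depend on the representative.
\<close>

lemma M_trans_coset:
  assumes "i \<le> l"
  shows "M_trans f i l (coset i r) = coset l (r * poly_c (f ^ (l - i)))"
proof -
  have J: "j * poly_c (f ^ (l - i)) \<in> M.RF l" if j: "j \<in> M.RF i" for j
  proof -
    obtain t where "j = t * poly_c (f ^ i)" using j by (auto simp: M.RF_def)
    then have "j * poly_c (f ^ (l - i)) = t * poly_c (f ^ l)"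
      using assms by (simp add: mult.assoc poly_c_eq_poly_at flip: poly_at_mult power_add)
    then show ?thesis by (auto simp: M.RF_def)
  qed
  have "coset l (s * poly_c (f ^ (l - i))) = coset l (r * poly_c (f ^ (l - i)))"
    if "s \<in> coset i r" for s
  proof -
    have "s - r \<in> M.RF i" using that by (auto simp: a_r_coset_def')
    then show ?thesis using J by (auto simp: coset_eq_iff simp flip: left_diff_distrib)
  qed
  moreover have "r \<in> coset i r" using zero_mem_RF by (force simp: a_r_coset_def')
  ultimately show ?thesis
    unfolding M_trans_def principal_left_ideal_eq by blast
qed

sublocale U: directed_system toeplitz_ring "{1..}" "M_mod f" "M_trans f"
proof (rule directed_system.intro)
  fix i j k :: nat and S
  show "M_trans f i j \<in> lmod_hom toeplitz_ring (M_mod f i) (M_mod f j)" if "i \<le> j"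
    using that
    by (intro lmod_homI) (auto simp: M_carrier M_trans_coset M_add M_smult distrib_right mult.assoc)
  show "M_trans f i i S = S" if "S \<in> carrier (M_mod f i)"
    using that by (auto simp: M_carrier M_trans_coset poly_c_eq_poly_at)
  show "M_trans f j k (M_trans f i j S) = M_trans f i k S"
    if "i \<le> j" "j \<le> k" "S \<in> carrier (M_mod f i)"
    using that
    by (auto simp: M_carrier M_trans_coset mult.assoc poly_c_eq_poly_at
        simp flip: poly_at_mult power_add)
  show "\<exists>k\<in>{1..}. i \<le> k \<and> j \<le> k" by (rule bexI[of _ "max 1 (max i j)"]) auto
qed (auto simp: left_module_M)

lemma U_mod_eq: "U_mod f = U.lim_mod"
  by (simp add: U_mod_def)

lemma left_module_U: "left_module toeplitz_ring (U_mod f)"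
  unfolding U_mod_eq by (rule U.left_module_lim)

text \<open>
  The fraction \<open>p / f ^ n\<close> in the Pruefer module: stage \<open>n\<close> is \<open>K[x]/f\<^sup>n\<close>, and the transition maps
  multiply by powers of \<open>f\<close>, so that numerator and denominator are expanded together.
\<close>

definition prufer_elt :: "nat \<Rightarrow> 'k poly \<Rightarrow> (nat \<times> 'k toeplitz_lpa set) set" where
  "prufer_elt n p = U.incl n (coset n (poly_c p))"

lemma coset_eq_poly_c: "coset n r = coset n (poly_c (M.lpa_poly n r))"
  by (simp add: coset_eq_iff M.diff_poly_c_lpa_poly_mem_RF)

lemma coset_poly_c_eq_iff: "coset n (poly_c p) = coset n (poly_c q) \<longleftrightarrow> f ^ n dvd p - q"
proof -
  have "[M.lpa_poly n (poly_c (p - q)) = p - q] (mod f ^ n)" by (rule M.lpa_poly_poly_c)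
  then have "f ^ n dvd M.lpa_poly n (poly_c (p - q)) \<longleftrightarrow> f ^ n dvd p - q" by (rule cong_dvd_iff)
  then show ?thesis
    by (simp add: coset_eq_iff M.mem_RF_iff poly_c_eq_poly_at poly_at_diff)
qed

lemma prufer_elt_closed: "n \<ge> 1 \<Longrightarrow> prufer_elt n p \<in> carrier (U_mod f)"
  by (simp add: prufer_elt_def U_mod_eq U.incl_closed M_carrier del: One_nat_def)

lemma U_cases:
  assumes "z \<in> carrier (U_mod f)"
  obtains n p where "n \<ge> 1" "z = prufer_elt n p"
proof -
  obtain n S where n: "n \<in> {1..}" "S \<in> carrier (M_mod f n)" "z = U.incl n S"
    using assms unfolding U_mod_eq by (rule U.lim_cases)
  obtain r where "S = coset n r" using n by (auto simp: M_carrier)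
  then have "z = prufer_elt n (M.lpa_poly n r)"
      using n coset_eq_poly_c[of n r] by (simp add: prufer_elt_def)
  then show ?thesis using that n by simp
qed

lemma prufer_elt_add: "n \<ge> 1 \<Longrightarrow> prufer_elt n p \<oplus>\<^bsub>U_mod f\<^esub> prufer_elt n q = prufer_elt n (p + q)"
  by (simp add: prufer_elt_def U_mod_eq U.incl_add M_carrier M_add poly_c_eq_poly_at poly_at_add
      del: One_nat_def)

lemma prufer_elt_zero: "n \<ge> 1 \<Longrightarrow> prufer_elt n 0 = \<zero>\<^bsub>U_mod f\<^esub>"
  using U.incl_zero[of n]
      by (simp add: prufer_elt_def U_mod_eq M_zero poly_c_eq_poly_at del: One_nat_def)

lemma prufer_elt_cong: "[p = q] (mod f ^ n) \<Longrightarrow> prufer_elt n p = prufer_elt n q"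
  using coset_poly_c_eq_iff[of n p q] by (simp add: prufer_elt_def cong_iff_dvd_diff)

lemma prufer_elt_smult:
  assumes "n \<ge> 1" "[M.lpa_poly n r = q] (mod f ^ n)"
  shows "r \<odot>\<^bsub>U_mod f\<^esub> prufer_elt n p = prufer_elt n (q * p)"
proof -
  have "[M.lpa_poly n (r * poly_c p) = M.lpa_poly n r * M.lpa_poly n (poly_c p)] (mod f ^ n)"
    by (rule M.lpa_poly_mult)
  also have "[M.lpa_poly n r * M.lpa_poly n (poly_c p) = q * p] (mod f ^ n)"
    by (intro cong_mult assms M.lpa_poly_poly_c)
  finally have "prufer_elt n (M.lpa_poly n (r * poly_c p)) = prufer_elt n (q * p)"
      by (rule prufer_elt_cong)
  then show ?thesis
    using assms(1) coset_eq_poly_c[of n "r * poly_c p"]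
    by (simp add: prufer_elt_def U_mod_eq U.incl_smult M_carrier M_smult del: One_nat_def)
qed

lemma prufer_elt_raise: "n \<ge> 1 \<Longrightarrow> prufer_elt (n + k) (f ^ k * p) = prufer_elt n p"
  using U.incl_trans[of n "n + k" "coset n (poly_c p)"]
  by (simp add: prufer_elt_def M_carrier M_trans_coset poly_c_eq_poly_at mult.commute
      del: One_nat_def flip: poly_at_mult)

text \<open>
  The transition maps are injective, because powers of \<open>f\<close> can be cancelled in \<open>K[x]\<close>; so a class
  that vanishes in the limit vanishes at its own stage.
\<close>

lemma prufer_elt_eq_zero_iff:
  assumes "n \<ge> 1"
  shows "prufer_elt n p = \<zero>\<^bsub>U_mod f\<^esub> \<longleftrightarrow> f ^ n dvd p"
proof
  assume "prufer_elt n p = \<zero>\<^bsub>U_mod f\<^esub>"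
  then have "prufer_elt n p = prufer_elt n 0" using prufer_elt_zero assms by simp
  then obtain k where k: "n \<le> k"
      "M_trans f n k (coset n (poly_c p)) = M_trans f n k (coset n (poly_c 0))"
    using assms U.incl_eq_iff[of n n] by (auto simp: prufer_elt_def M_carrier simp del: One_nat_def)
  then have "coset k (poly_c (p * f ^ (k - n))) = coset k (poly_c 0)"
    by (simp add: M_trans_coset poly_c_eq_poly_at poly_at_mult)
  then have "f ^ k dvd p * f ^ (k - n)" by (simp add: coset_poly_c_eq_iff)
  moreover have "f ^ k = f ^ n * f ^ (k - n)" using k by (simp flip: power_add)
  ultimately show "f ^ n dvd p" using f_nonzero by simp
next
  assume "f ^ n dvd p"
  then show "prufer_elt n p = \<zero>\<^bsub>U_mod f\<^esub>"
    using prufer_elt_cong[of p 0 n] prufer_elt_zero assms by (simp add: cong_0_iff)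
qed

section \<open>Injectivity of \<open>U\<^sup>f\<close>\<close>

interpretation UM: left_module toeplitz_ring "U_mod f"
  by (rule left_module_U)

text \<open>
  On fractions with denominator \<open>f ^ n\<close> the shift multiplies numerators by an inverse of \<open>x\<close>
  modulo \<open>f ^ n\<close>.
\<close>

lemma shift_power_injective:
  assumes "z \<in> carrier (U_mod f)" "lpa_shift ^ m \<odot>\<^bsub>U_mod f\<^esub> z = \<zero>\<^bsub>U_mod f\<^esub>"
  shows "z = \<zero>\<^bsub>U_mod f\<^esub>"
  using assms(2)
proof (induction m)
  case 0
  then show ?case using assms(1) UM.smult_one by simp
next
  case (Suc m)
  obtain n p where n: "n \<ge> 1" "lpa_shift ^ m \<odot>\<^bsub>U_mod f\<^esub> z = prufer_elt n p"
    using U_cases[of "lpa_shift ^ m \<odot>\<^bsub>U_mod f\<^esub> z"]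
        UM.smult_closed[of "lpa_shift ^ m" z] assms(1) by auto
  have "prufer_elt n (inv_X n * p) = lpa_shift \<odot>\<^bsub>U_mod f\<^esub> (lpa_shift ^ m \<odot>\<^bsub>U_mod f\<^esub> z)"
    using n by (simp add: prufer_elt_smult[OF _ M.lpa_poly_shift])
  also have "\<dots> = lpa_shift ^ Suc m \<odot>\<^bsub>U_mod f\<^esub> z"
    using UM.smult_assoc[of lpa_shift "lpa_shift ^ m" z] assms(1) by simp
  finally have "f ^ n dvd inv_X n * p" using Suc.prems n prufer_elt_eq_zero_iff by simp
  then have "f ^ n dvd [:0, 1:] * inv_X n * p"
    using dvd_mult[of "f ^ n" "inv_X n * p" "[:0, 1:]"] by (simp only: mult.assoc)
  moreover have "[[:0, 1:] * inv_X n * p = 1 * p] (mod f ^ n)"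
    by (intro cong_mult M.inverse_mod cong_refl)
  ultimately have "f ^ n dvd p" using cong_dvd_iff by fastforce
  then have "lpa_shift ^ m \<odot>\<^bsub>U_mod f\<^esub> z = \<zero>\<^bsub>U_mod f\<^esub>" using n prufer_elt_eq_zero_iff by simp
  then show ?case by (rule Suc.IH)
qed

text \<open>
  Up to the invertible factor \<open>x\<close> to the degree of \<open>q\<close>, the element \<open>q(y)\<close> acts as the reversed
  polynomial \<open>f ^ k * q'\<close>, where \<open>f\<close> does not divide \<open>q'\<close>. Multiplication by \<open>q'\<close> is invertible on
  each stage. Division by \<open>f ^ k\<close> replaces the denominator \<open>f ^ n\<close> by \<open>f ^ (n + k)\<close>.
\<close>

lemma poly_at_shift_surjective:
  assumes q: "q \<noteq> 0" and z: "z \<in> carrier (U_mod f)"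
  shows "\<exists>e\<in>carrier (U_mod f). poly_at q lpa_shift \<odot>\<^bsub>U_mod f\<^esub> e = z"
proof -
  obtain n p where n: "n \<ge> 1" "z = prufer_elt n p" using z by (rule U_cases)
  have "reflect_poly q \<noteq> 0" using q by simp
  then obtain k q' where k: "reflect_poly q = f ^ k * q'" "\<not> f dvd q'"
    by (rule ex_irreducible_power_factor[OF irreducible_f])
  let ?m = "n + k"
  let ?X = "[:0, 1:] ^ degree q"
  obtain s where s: "[q' * s = 1] (mod f ^ ?m)"
    using ex_inverse_mod_irreducible_power[OF irreducible_f k(2)] by blast
  \<comment> \<open>The numerator inverts \<open>q'\<close>, and \<open>?X\<close> turns \<open>q(1/x)\<close> into the reversed polynomial.\<close>
  have "poly_at q lpa_shift \<odot>\<^bsub>U_mod f\<^esub> prufer_elt ?m (?X * s * p)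
      = prufer_elt ?m (pcompose q (inv_X ?m) * (?X * s * p))"
    using n by (intro prufer_elt_smult M.lpa_poly_poly_at M.lpa_poly_shift) simp
  also have "\<dots> = prufer_elt ?m (f ^ k * p)"
  proof (rule prufer_elt_cong)
    have "pcompose q (inv_X ?m) * (?X * s * p) = (?X * pcompose q (inv_X ?m)) * (s * p)"
      by (simp only: mult_ac)
    also have "[\<dots> = reflect_poly q * (s * p)] (mod f ^ ?m)"
      by (intro cong_mult cong_refl X_power_mult_pcompose_cong M.inverse_mod)
    also have "reflect_poly q * (s * p) = f ^ k * ((q' * s) * p)"
      by (simp only: k mult_ac)
    also have "[\<dots> = f ^ k * (1 * p)] (mod f ^ ?m)"
      by (intro cong_mult cong_refl s)
    finally show "[pcompose q (inv_X ?m) * (?X * s * p) = f ^ k * p] (mod f ^ ?m)" by simp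
  qed
  also have "\<dots> = z" using n prufer_elt_raise by simp
  finally show ?thesis using n prufer_elt_closed[of ?m] by auto
qed

text \<open>
  The generator \<open>q\<close> of the ideal of all polynomials \<open>p\<close> with \<open>p(y) \<in> I\<close> determines \<open>\<phi>\<close>: solving
  \<open>q(y) e = \<phi> (q(y))\<close> for \<open>e\<close> makes \<open>\<phi>\<close> agree with right multiplication by \<open>e\<close> on \<open>I \<inter> K[y]\<close>, and
  each \<open>r \<in> I\<close> is moved into \<open>I \<inter> K[y]\<close> by a power of \<open>y\<close>, which acts injectively.
\<close>

lemma injective_U: "injective_left_module TYPE('a) TYPE('b) toeplitz_ring (U_mod f)"
proof (rule baer_criterion[OF left_module_U], intro allI impI ballI)
  fix I \<phi>
  assume I: "left_ideal I (toeplitz_ring :: 'k toeplitz_lpa ring)"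
    and \<phi>: "\<phi> \<in> lmod_hom toeplitz_ring (left_ideal_module toeplitz_ring I) (U_mod f)"
  have I_mult: "r * t \<in> I" if "t \<in> I" for r t
    using I that by (auto simp: left_ideal_def)
  have I_add: "r + t \<in> I" if "r \<in> I" "t \<in> I" for r t
    using I that by (auto simp: left_ideal_def)
  have I_zero: "0 \<in> I" using I by (auto simp: left_ideal_def)
  have \<phi>_closed: "\<phi> r \<in> carrier (U_mod f)" if "r \<in> I" for r
    using lmod_hom_closed[OF \<phi>] that by (simp add: left_ideal_module_def)
  have \<phi>_smult: "\<phi> (r * t) = r \<odot>\<^bsub>U_mod f\<^esub> \<phi> t" if "t \<in> I" for r t
    using lmod_hom_smult[OF \<phi>, of r t] that by (simp add: left_ideal_module_def)
  define A where "A = {p. poly_at p lpa_shift \<in> I}"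
  obtain q where q: "q \<in> A" and q_dvd: "\<And>p. p \<in> A \<Longrightarrow> q dvd p"
  proof (rule poly_ideal_principal)
    show "0 \<in> A" by (simp add: A_def I_zero)
    show "p + p' \<in> A" if "p \<in> A" "p' \<in> A" for p p'
      using that by (simp add: A_def poly_at_add I_add)
    show "p * p' \<in> A" if "p' \<in> A" for p p'
      using that by (simp add: A_def poly_at_mult I_mult)
  qed blast
  then have qI: "poly_at q lpa_shift \<in> I" by (simp add: A_def)
  obtain e where e: "e \<in> carrier (U_mod f)"
    "poly_at q lpa_shift \<odot>\<^bsub>U_mod f\<^esub> e = \<phi> (poly_at q lpa_shift)"
  proof (cases "q = 0")
    case True
    have "\<phi> 0 = \<zero>\<^bsub>U_mod f\<^esub>"
      using \<phi>_smult[OF I_zero, of 0] UM.smult_zero_left[of "\<phi> 0"] \<phi>_closed[OF I_zero] by simp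
    then show ?thesis
      using that[of "\<zero>\<^bsub>U_mod f\<^esub>"] True UM.smult_zero_right[of 0] by simp
  next
    case False
    then show ?thesis
      using poly_at_shift_surjective[OF False \<phi>_closed[OF qI]] that by blast
  qed
  have "\<phi> r = r \<odot>\<^bsub>U_mod f\<^esub> e" if r: "r \<in> I" for r
  proof -
    obtain n p where p: "lpa_shift ^ n * r = poly_at p lpa_shift"
      using ex_shift_power_mult_eq_poly_at by blast
    have "poly_at p lpa_shift \<in> I" using I_mult[OF r] p by metis
    then have "q dvd p" by (intro q_dvd) (simp add: A_def)
    then obtain h where h: "p = h * q" by (metis dvdE mult.commute)
    have "lpa_shift ^ n \<odot>\<^bsub>U_mod f\<^esub> \<phi> r = \<phi> (poly_at h lpa_shift * poly_at q lpa_shift)"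
      using \<phi>_smult[OF r, of "lpa_shift ^ n"] p h by (simp add: poly_at_mult)
    also have "\<dots> = poly_at h lpa_shift \<odot>\<^bsub>U_mod f\<^esub> (poly_at q lpa_shift \<odot>\<^bsub>U_mod f\<^esub> e)"
      using \<phi>_smult[OF qI] e by simp
    also have "\<dots> = lpa_shift ^ n \<odot>\<^bsub>U_mod f\<^esub> (r \<odot>\<^bsub>U_mod f\<^esub> e)"
      using UM.smult_assoc[of "lpa_shift ^ n" r e]
          UM.smult_assoc[of "poly_at h lpa_shift" "poly_at q lpa_shift" e]
        e p h by (simp add: poly_at_mult)
    finally have eq: "lpa_shift ^ n \<odot>\<^bsub>U_mod f\<^esub> \<phi> r = lpa_shift ^ n \<odot>\<^bsub>U_mod f\<^esub> (r \<odot>\<^bsub>U_mod f\<^esub> e)" .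
    show ?thesis
    proof (rule UM.smult_cancel[OF _ _ _ _ eq])
      show "z = \<zero>\<^bsub>U_mod f\<^esub>"
        if "z \<in> carrier (U_mod f)" "lpa_shift ^ n \<odot>\<^bsub>U_mod f\<^esub> z = \<zero>\<^bsub>U_mod f\<^esub>" for z
        using that by (rule shift_power_injective)
      show "\<phi> r \<in> carrier (U_mod f)" using r by (rule \<phi>_closed)
      show "r \<odot>\<^bsub>U_mod f\<^esub> e \<in> carrier (U_mod f)" by (rule UM.smult_closed) (simp_all add: e)
    qed simp
  qed
  then show "\<exists>e\<in>carrier (U_mod f). \<forall>r\<in>I. \<phi> r = r \<odot>\<^bsub>U_mod f\<^esub> e" using e by blast
qed

end

section \<open>The simple module \<open>V\<^sup>f\<close>\<close>

context prufer
begin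

lemma gen_scalar_eq: "gen_scalar f h = residue f (gen_poly (inv_X 1) h)"
proof (cases h)
  case GC'
  interpret cring "residue_field f" by (rule cring_residue_field)
  have "inv\<^bsub>residue_field f\<^esub> residue f [:0, 1:] = residue f (inv_X 1)"
    using M.inverse_mod[of 1]
    by (intro comm_inv_char residue_closed)
       (simp add: residue_mult residue_one residue_eq_iff cong_iff_dvd_diff)
  then show ?thesis using GC' by simp
qed (simp_all add: residue_one residue_zero)

text \<open>
  On \<open>V\<^sup>f\<close> each generator multiplies by an element of the commutative ring \<open>K'\<close>, so the action can
  be computed with representatives in \<open>K[x]\<close>, by the map that defines the homomorphism to
  \<open>K[x]/f\<close>.
\<close>

lemma word_act_residue: "word_act f w (residue f p) = residue f (word_poly (inv_X 1) w * p)"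
  by (induction w) (simp_all add: word_act_def word_poly_def gen_scalar_eq residue_mult mult.assoc)

lemma free_act_residue: "free_act f a (residue f p) = residue f (free_poly (inv_X 1) a * p)"
  by (simp add: free_act_def word_act_residue residue_mult residue_sum free_poly_def
      sum_distrib_right)

lemma V_carrier: "carrier (V_mod f) = range (residue f)"
  by (simp add: V_mod_def residue_carrier)

lemma V_zero: "\<zero>\<^bsub>V_mod f\<^esub> = residue f 0"
  by (simp add: V_mod_def residue_zero)

lemma V_add: "residue f p \<oplus>\<^bsub>V_mod f\<^esub> residue f q = residue f (p + q)"
  by (simp add: V_mod_def residue_add)

lemma V_smult: "r \<odot>\<^bsub>V_mod f\<^esub> residue f p = residue f (M.lpa_poly 1 r * p)"
  by (simp add: V_mod_def free_act_residue M.lpa_poly_def)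

lemma residue_cong: "[p = q] (mod f ^ 1) \<Longrightarrow> residue f p = residue f q"
  by (simp add: residue_eq_iff cong_iff_dvd_diff)

lemma V_smult_poly_c: "poly_c q \<odot>\<^bsub>V_mod f\<^esub> residue f p = residue f (q * p)"
  unfolding V_smult by (intro residue_cong cong_mult M.lpa_poly_poly_c cong_refl)

lemma left_module_V: "left_module toeplitz_ring (V_mod f)"
proof (intro left_module.intro left_module_axioms.intro ring_toeplitz_ring)
  show "abelian_group (V_mod f)"
  proof (rule abelian_groupI)
    fix y assume "y \<in> carrier (V_mod f)"
    then obtain p where "y = residue f p" by (auto simp: V_carrier)
    then have "residue f (- p) \<oplus>\<^bsub>V_mod f\<^esub> y = \<zero>\<^bsub>V_mod f\<^esub>" by (simp add: V_add V_zero)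
    then show "\<exists>z\<in>carrier (V_mod f). z \<oplus>\<^bsub>V_mod f\<^esub> y = \<zero>\<^bsub>V_mod f\<^esub>"
      by (auto simp: V_carrier)
  qed (auto simp: V_carrier V_add V_zero algebra_simps)
next
  fix a b :: "'k toeplitz_lpa" and y assume "y \<in> carrier (V_mod f)"
  then obtain p where y: "y = residue f p" by (auto simp: V_carrier)
  have "residue f (M.lpa_poly 1 (a + b) * p) = residue f ((M.lpa_poly 1 a + M.lpa_poly 1 b) * p)"
    "residue f (M.lpa_poly 1 (a * b) * p) = residue f ((M.lpa_poly 1 a * M.lpa_poly 1 b) * p)"
    "residue f (M.lpa_poly 1 1 * p) = residue f (1 * p)"
    by (intro residue_cong cong_mult M.lpa_poly_add M.lpa_poly_mult M.lpa_poly_1 cong_refl)+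
  then show "(a \<oplus>\<^bsub>toeplitz_ring\<^esub> b) \<odot>\<^bsub>V_mod f\<^esub> y = a \<odot>\<^bsub>V_mod f\<^esub> y \<oplus>\<^bsub>V_mod f\<^esub> b \<odot>\<^bsub>V_mod f\<^esub> y"
    and "(a \<otimes>\<^bsub>toeplitz_ring\<^esub> b) \<odot>\<^bsub>V_mod f\<^esub> y = a \<odot>\<^bsub>V_mod f\<^esub> (b \<odot>\<^bsub>V_mod f\<^esub> y)"
    and "\<one>\<^bsub>toeplitz_ring\<^esub> \<odot>\<^bsub>V_mod f\<^esub> y = y"
    by (simp_all add: y V_smult V_add distrib_right mult.assoc)
qed (auto simp: V_carrier V_smult V_add distrib_left)

lemma residue_eq_zero_iff: "residue f p = residue f 0 \<longleftrightarrow> f dvd p"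
  by (simp add: residue_eq_iff)

text \<open>
  A nonzero class modulo \<open>f\<close> has an inverse \<open>s\<close>, so \<open>(q s)(c)\<close> carries it to the class of \<open>q\<close>.
\<close>

lemma simple_V: "simple_left_module toeplitz_ring (V_mod f)"
  unfolding simple_left_module_def
proof (intro conjI allI impI left_module_V)
  have "residue f 1 \<noteq> residue f 0" using f_not_unit by (simp add: residue_eq_zero_iff)
  then show "carrier (V_mod f) \<noteq> {\<zero>\<^bsub>V_mod f\<^esub>}" by (auto simp: V_carrier V_zero)
  fix N assume "submodule N toeplitz_ring (V_mod f)"
  note N = submoduleD[OF this]
  show "N = {\<zero>\<^bsub>V_mod f\<^esub>} \<or> N = carrier (V_mod f)"
  proof (cases "N = {\<zero>\<^bsub>V_mod f\<^esub>}")
    case False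
    then obtain y where y: "y \<in> N" "y \<noteq> \<zero>\<^bsub>V_mod f\<^esub>" using N(2) by blast
    then obtain p where "y = residue f p" using N(1) by (auto simp: V_carrier)
    with y have p: "residue f p \<in> N" "residue f p \<noteq> residue f 0" by (simp_all add: V_zero)
    then have "\<not> f dvd p" by (simp add: residue_eq_zero_iff)
    then obtain s where s: "[p * s = 1] (mod f ^ 1)"
      using ex_inverse_mod_irreducible_power[OF irreducible_f] by blast
    have "residue f q \<in> N" for q
    proof -
      have "residue f (q * s * p) = residue f (q * 1)"
        using cong_mult[OF cong_refl s, of q] by (intro residue_cong) (simp only: mult_ac)
      then show ?thesis
        using N(3)[of "poly_c (q * s)", OF _ p(1)] by (simp add: V_smult_poly_c)
    qed
    then show ?thesis using N(1) by (auto simp: V_carrier)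
  qed simp
qed

lemma M1_to_V_coset: "M1_to_V f (coset 1 r) = residue f (M.lpa_poly 1 r)"
proof -
  have "s \<odot>\<^bsub>V_mod f\<^esub> c_inf f = residue f (M.lpa_poly 1 r)" if "s \<in> coset 1 r" for s
  proof -
    have "s - r \<in> M.RF 1" using that by (auto simp: a_r_coset_def')
    then have "[M.lpa_poly 1 (s - r) = 0] (mod f ^ 1)" by (simp only: M.mem_RF_iff cong_0_iff)
    then have "[M.lpa_poly 1 s - M.lpa_poly 1 r = 0] (mod f ^ 1)"
      using M.lpa_poly_diff[of 1 s r] cong_sym cong_trans by blast
    then show ?thesis
      by (simp add: c_inf_def residue_one V_smult residue_eq_iff cong_0_iff)
  qed
  moreover have "r \<in> coset 1 r" using zero_mem_RF[of 1] by (force simp: a_r_coset_def')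
  ultimately have "(\<lambda>r. r \<odot>\<^bsub>V_mod f\<^esub> c_inf f) ` coset 1 r = {residue f (M.lpa_poly 1 r)}" by blast
  then show ?thesis by (simp add: M1_to_V_def)
qed

text \<open>
  The coset of \<open>p(c)\<close> is the only one that the isomorphism \<open>M\<^sub>1\<^sup>f \<cong> V\<^sup>f\<close> sends to the residue of \<open>p\<close>.
\<close>

lemma V_to_U_residue: "V_to_U f (residue f p) = prufer_elt 1 p"
proof -
  have "M1_to_V f (coset 1 (poly_c q)) = residue f q" for q
    unfolding M1_to_V_coset by (intro residue_cong M.lpa_poly_poly_c)
  moreover have "inj_on (M1_to_V f) (carrier (M_mod f 1))"
  proof (rule inj_onI)
    fix S T assume "S \<in> carrier (M_mod f 1)" "T \<in> carrier (M_mod f 1)" "M1_to_V f S = M1_to_V f T"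
    then obtain r s where *: "S = coset 1 r" "T = coset 1 s"
      "residue f (M.lpa_poly 1 r) = residue f (M.lpa_poly 1 s)"
      by (auto simp: M_carrier M1_to_V_coset simp del: One_nat_def power_one_right)
    then show "S = T"
      using coset_eq_poly_c[of 1 r] coset_eq_poly_c[of 1 s]
        coset_poly_c_eq_iff[of 1 "M.lpa_poly 1 r" "M.lpa_poly 1 s"]
      by (simp add: residue_eq_iff)
  qed
  moreover have "coset 1 (poly_c p) \<in> carrier (M_mod f 1)" by (auto simp: M_carrier)
  ultimately have "inv_into (carrier (M_mod f 1)) (M1_to_V f) (residue f p) = coset 1 (poly_c p)"
    by (metis inv_into_f_f)
  then show ?thesis by (simp add: V_to_U_def prufer_elt_def)
qed

section \<open>\<open>V\<^sup>f\<close> as an essential submodule of \<open>U\<^sup>f\<close>\<close>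

text \<open>
  A nonzero fraction in lowest terms has the form \<open>p' / f ^ (1 + m)\<close> with \<open>f\<close> not dividing \<open>p'\<close>.
  Multiplied by \<open>f ^ m\<close> and by an inverse of \<open>p'\<close>, it becomes \<open>1 / f\<close>, a nonzero element of the
  image of \<open>V\<^sup>f\<close>.
\<close>

lemma essential_V_to_U:
  "essential_monomorphism toeplitz_ring (V_mod f) (U_mod f) (V_to_U f)"
  unfolding essential_monomorphism_def
proof (intro conjI allI impI left_module_V left_module_U)
  show hom: "V_to_U f \<in> lmod_hom toeplitz_ring (V_mod f) (U_mod f)"
    by (rule lmod_homI)
       (auto simp: V_carrier V_to_U_residue V_add V_smult prufer_elt_closed prufer_elt_add
           prufer_elt_smult[OF _ cong_refl]
         simp del: One_nat_def)
  show "inj_on (V_to_U f) (carrier (V_mod f))"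
  proof (rule inj_onI)
    fix y z assume "y \<in> carrier (V_mod f)" "z \<in> carrier (V_mod f)" and eq: "V_to_U f y = V_to_U f z"
    then obtain p q where pq: "y = residue f p" "z = residue f q" by (auto simp: V_carrier)
    have "prufer_elt 1 (p - q) = prufer_elt 1 p \<oplus>\<^bsub>U_mod f\<^esub> prufer_elt 1 (- q)"
        by (simp add: prufer_elt_add)
    also have "\<dots> = prufer_elt 1 q \<oplus>\<^bsub>U_mod f\<^esub> prufer_elt 1 (- q)"
        using eq by (simp add: pq V_to_U_residue)
    also have "\<dots> = \<zero>\<^bsub>U_mod f\<^esub>" by (simp add: prufer_elt_add prufer_elt_zero)
    finally show "y = z" using prufer_elt_eq_zero_iff[of 1 "p - q"] by (simp add: pq residue_eq_iff)
  qed
  fix N assume "submodule N toeplitz_ring (U_mod f) \<and> N \<noteq> {\<zero>\<^bsub>U_mod f\<^esub>}"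
  then have N: "submodule N toeplitz_ring (U_mod f)" and nz: "N \<noteq> {\<zero>\<^bsub>U_mod f\<^esub>}" by auto
  note N = submoduleD[OF N]
  obtain z where z: "z \<in> N" "z \<noteq> \<zero>\<^bsub>U_mod f\<^esub>" using N(2) nz by blast
  then obtain n p where n: "n \<ge> 1" "z = prufer_elt n p" using N(1) U_cases by blast
  have "\<not> f ^ n dvd p" using z n prufer_elt_eq_zero_iff by simp
  then have "p \<noteq> 0" by auto
  then obtain j p' where p: "p = f ^ j * p'" "\<not> f dvd p'"
    by (rule ex_irreducible_power_factor[OF irreducible_f])
  have "j < n"
  proof (rule ccontr)
    assume "\<not> j < n"
    then have "f ^ n dvd p" unfolding p by (intro dvd_mult2 le_imp_power_dvd) simp
    then show False using \<open>\<not> f ^ n dvd p\<close> by contradiction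
  qed
  define m where "m = n - j - 1"
  have m: "n = (1 + m) + j" using \<open>j < n\<close> by (simp add: m_def)
  obtain s where s: "[p' * s = 1] (mod f ^ (1 + m))"
    using ex_inverse_mod_irreducible_power[OF irreducible_f p(2)] by blast
  have "poly_c (f ^ m * s) \<odot>\<^bsub>U_mod f\<^esub> z = poly_c (f ^ m * s) \<odot>\<^bsub>U_mod f\<^esub> prufer_elt (1 + m) p'"
    using prufer_elt_raise[of "1 + m" j p'] by (simp add: n(2) p(1) m)
  also have "\<dots> = prufer_elt (1 + m) (f ^ m * s * p')"
    by (intro prufer_elt_smult M.lpa_poly_poly_c) simp
  also have "\<dots> = prufer_elt (1 + m) (f ^ m * 1)"
    using cong_mult[OF cong_refl s, of "f ^ m"] by (intro prufer_elt_cong) (simp only: mult_ac)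
  also have "\<dots> = prufer_elt 1 1" by (rule prufer_elt_raise) simp
  finally have "prufer_elt 1 1 \<in> N" using N(3)[of "poly_c (f ^ m * s)", OF _ z(1)] by simp
  moreover have "prufer_elt 1 1 \<in> V_to_U f ` carrier (V_mod f)"
    by (auto simp: V_carrier image_image V_to_U_residue simp del: One_nat_def)
  moreover have "prufer_elt 1 1 \<noteq> \<zero>\<^bsub>U_mod f\<^esub>" using prufer_elt_eq_zero_iff[of 1 1] f_not_unit by simp
  ultimately show "N \<inter> V_to_U f ` carrier (V_mod f) \<noteq> {\<zero>\<^bsub>U_mod f\<^esub>}" by blast
qed

end

theorem corollary19:
  fixes f :: "'k::field poly"
  assumes "irreducible f" and "poly f 0 = -1"
  shows "simple_left_module toeplitz_ring (V_mod f) \<and>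
    injective_envelope TYPE('a) TYPE('b) toeplitz_ring (V_mod f) (U_mod f) (V_to_U f)"
proof -
  interpret prufer f using assms by unfold_locales
  show ?thesis
    unfolding injective_envelope_def using simple_V injective_U essential_V_to_U by blast
qed

end
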